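(* Let $\mathfrak{s}=(s_1,\dots,s_r)\in\mathbb{N}^r$ and $\mathbf{u}=(u_1,\dots,u_r)\in(\overline{k}^\times)^r$ with $|u_i|_v\leq 1$ for all $i$. Define $\tilde{\mathfrak{s}}=(s_r,\dots,s_1)$, $\tilde{\mathbf{u}}=(u_r,\dots,u_1)$ and $\tilde{d}_\ell:=s_{r+1-\ell}+\cdots+s_1$ for $1\leq\ell\leq r$. Consider the $t$-module $G_{\tilde{\mathfrak{s}},\tilde{\mathbf{u}}}$, the special point $\mathbf{v}_{\tilde{\mathfrak{s}},\tilde{\mathbf{u}}}$ (both as constructed in the context below, applied to the pair $(\tilde{\mathfrak{s}},\tilde{\mathbf{u}})$), and any nonzero polynomial $a(t)\in\mathbb{F}_q[t]$ such that $\rho_a(\mathbf{v}_{\tilde{\mathfrak{s}},\tilde{\mathbf{u}}})\in G_{\tilde{\mathfrak{s}},\tilde{\mathbf{u}}}(\mathfrak{m}_v)$. Write $\rho_a(\mathbf{v}_{\tilde{\mathfrak{s}},\tilde{\mathbf{u}}})=(V_1,\dots,V_r)^{\mathrm{tr}}$ with $V_m=(V_{m,1},\dots,V_{m,\tilde{d}_m})^{\mathrm{tr}}\in\overline{k}^{\tilde{d}_m}$. Then $$\mathrm{Li}_{\mathfrak{s}}^\star(\mathbf{u})_v=\frac{(-1)^{r-1}}{a(\theta)}\sum_{m=1}^{r}\sum_{j=0}^{\tilde{d}_m-1}\sum_{\ell=0}^{j}(-1)^{j+\ell+m-1}\binom{j}{\ell}\theta^\ell\Big\{\mathrm{Li}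_{\mathfrak{s}_{(r+1-m)}}^\star(\theta^{j-\ell}V_{m,\tilde{d}_m-j},u_{r+2-m},\dots,u_r)_v-\mathrm{Li}_{\mathfrak{s}_{(r+2-m)}}^\star(\theta^{j-\ell}V_{m,\tilde{d}_m-j}u_{r+2-m},u_{r+3-m},\dots,u_r)_v\Big\}.$$
   Context: Notation: $A=\mathbb{F}_q[\theta]$, $k=\mathbb{F}_q(\theta)$, $v$ a monic irreducible polynomial in $A$ (finite place), $|\cdot|_v$ the normalized $v$-adic absolute value, $\mathbb{C}_v$ the completion of an algebraic closure of $k_v$, $\mathfrak{m}_v$ the maximal ideal of its valuation ring, $\overline{k}$ an algebraic closure of $k$ embedded in $\mathbb{C}_v$, $\tau$ the $q$-th power Frobenius. Set $[i]:=\theta^{q^i}-\theta$, $L_0:=1$, $L_i:=(-1)^i[i][i-1]\cdots[1]$. Construction of $G_{\mathfrak{s},\mathbf{u}}$ and $\mathbf{v}_{\mathfrak{s},\mathbf{u}}$ for $\mathfrak{s}=(s_1,\dots,s_r)$, $\mathbf{u}=(u_1,\dots,u_r)\in(\overline{k}^\times)^r$: put $d_\ell:=s_\ell+\cdots+s_r$ and $d:=d_1+\cdots+d_r$. Let $N_\ell\in\mathrm{Mat}_{d_\ell}(\overline{k})$ be the nilpotent matrix with $1$'s on the superdiagonal and $0$ elsewhere, and $N:=\mathrm{diag}(N_1,\dots,N_r)$. Let $E\in\mathrm{Mat}_d(\overline{k})$ be block upper triangular with blocks $E[\ell m]\in\mathrm{Mat}_{d_\ell\times d_m}(\overline{k})$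 ($\ell\le m$), where $E[\ell m]$ has a single nonzero entry in its bottom-left corner (row $d_\ell$, column $1$), equal to $1$ if $\ell=m$ and to $(-1)^{m-\ell}\prod_{e=\ell}^{m-1}u_e$ if $\ell<m$; blocks with $\ell>m$ are zero. The $t$-module $G_{\mathfrak{s},\mathbf{u}}=(\mathbb{G}_a^d,\rho)$ is given by $\rho_t=\theta I_d+N+E\tau$. The point $\mathbf{v}_{\mathfrak{s},\mathbf{u}}\in\overline{k}^d$ is the column vector which, in the $\ell$-th block (of length $d_\ell$), has zeros except the last entry equal to $(-1)^{r-\ell}u_\ell u_{\ell+1}\cdots u_r$. The logarithm $\log_G=\sum_{i\ge0}P_i\tau^i$ ($P_0=I_d$) is the unique $\mathbb{F}_q$-linear power series with $\log_G\circ\rho_a=\partial\rho_a\circ\log_G$ for all $a\in\mathbb{F}_q[t]$, where $\partial$ takes the $\tau^0$-coefficient. Such $a(t)$ exist (e.g. $a(t)=\prod_{\ell}(v(t)^{d_\ell \cdot n}-1)$ for suitable $n$). Definition of $v$-adic CMSPLs: for $\mathfrak{s}\in\mathbb{N}^r$, $\mathbf{u}\in(\overline{k}^\times)^r$ with $|u_i|_v\le1$, $\mathrm{Li}^\star_{\mathfrak{s}}(\mathbf{u})_v:=\frac{(-1)^{r-1}}{a(\theta)}\times$ (the $\tilde{d}_1$-th coordinate of $\log_{G_{\tilde{\mathfrak{s}},\tilde{\mathbf{u}}}}(\rho_a(\mathbf{v}_{\tilde{\mathfrak{s}},\tilde{\mathbf{u}}}))$), for any nonzero $a(t)$ as in the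 claim; this is independent of $a$ and, when $|u_1|_v<1$, equals $\sum_{i_1\ge\cdots\ge i_r\ge0}\frac{u_1^{q^{i_1}}\cdots u_r^{q^{i_r}}}{L_{i_1}^{s_1}\cdots L_{i_r}^{s_r}}$. Index notation: $\mathfrak{s}_{(i)}:=(s_1+\cdots+s_i,s_{i+1},\dots,s_r)$ for $1\le i\le r$, $\mathfrak{s}_{(i)}:=\varnothing$ for $i>r$ or $i<0$, and $\mathrm{Li}^\star_{\varnothing}:=0$. *)

theory Defs
  imports
    Complex_Main
    "HOL-Library.Cardinality"
    "HOL-Analysis.Elementary_Topology"
    "HOL-Computational_Algebra.Polynomial"
    "HOL-Computational_Algebra.Fraction_Field"
    "HOL-Computational_Algebra.Factorial_Ring"
    "Jordan_Normal_Form.Matrix"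
begin

text \<open>
  A finite field with \<open>q\<close> elements is a type \<open>'f\<close> of class \<open>{field, finite}\<close>, so \<open>q = CARD('f)\<close>;
  \<open>A\<close> is \<open>'f poly\<close> and \<open>k\<close> is \<open>'f poly fract\<close>.  The field \<open>\<complex>\<^sub>v\<close> is a type \<open>'c\<close> carrying a complete
  metric, together with the structure map \<open>\<iota>\<close> from \<open>k\<close>.
\<close>

section \<open>The field \<open>\<complex>\<^sub>v\<close>\<close>

definition absv :: "'c::{field,metric_space} \<Rightarrow> real" where
  "absv x = dist x 0"

definition max_ideal :: "'c::{field,metric_space} set" where
  "max_ideal = {x. absv x < 1}"

definition alg_over :: "'c::field set \<Rightarrow> 'c set" where
  "alg_over K = {x. \<exists>p. p \<noteq> 0 \<and> set (coeffs p) \<subseteq> K \<and> poly p x = 0}"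

definition v_order :: "'f::field poly \<Rightarrow> 'f poly \<Rightarrow> nat" where
  "v_order v a = Max {n. v ^ n dvd a}"

text \<open>
  \<open>'c\<close> is the completion of an algebraic closure of \<open>k\<^sub>v\<close>: the completion \<open>k\<^sub>v\<close> of \<open>k\<close> is the
  closure of the image of \<open>k\<close> in the complete field \<open>'c\<close>, and the elements of \<open>'c\<close> that are
  algebraic over \<open>k\<^sub>v\<close> form an algebraically closed, dense subset.
\<close>

locale v_adic_complex_field =
  fixes v :: "'f::{field,finite} poly"
    and \<iota> :: "'f poly fract \<Rightarrow> 'c::{field,complete_space}"
  assumes v_monic: "lead_coeff v = 1"
    and v_irreducible: "irreducible v"
    and dist_absv: "dist (x::'c) y = absv (x - y)"
    and absv_mult: "absv ((x::'c) * y) = absv x * absv y"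
    and absv_ultrametric: "absv ((x::'c) + y) \<le> max (absv x) (absv y)"
    and field_hom_\<iota>: "field_hom \<iota>"
    and absv_\<iota>: "a \<noteq> 0 \<Longrightarrow> b \<noteq> 0 \<Longrightarrow>
      absv (\<iota> (Fract a b)) =
        real CARD('f) powi (- int (degree v) * (int (v_order v a) - int (v_order v b)))"
    and kv_bar_alg_closed: "degree p > 0 \<Longrightarrow> set (coeffs p) \<subseteq> alg_over (closure (range \<iota>)) \<Longrightarrow>
      \<exists>x \<in> alg_over (closure (range \<iota>)). poly p x = 0"
    and kv_bar_dense: "closure (alg_over (closure (range \<iota>))) = UNIV"

text \<open>The algebraic closure of \<open>k\<close> inside \<open>\<complex>\<^sub>v\<close>.\<close>

definition k_bar :: "('f::{field,finite} poly fract \<Rightarrow> 'c::field) \<Rightarrow> 'c set" where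
  "k_bar \<iota> = alg_over (range \<iota>)"

definition theta :: "('f::{field,finite} poly fract \<Rightarrow> 'c::field) \<Rightarrow> 'c" where
  "theta \<iota> = \<iota> (Fract [:0, 1:] 1)"

definition fq_embed :: "('f::{field,finite} poly fract \<Rightarrow> 'c::field) \<Rightarrow> 'f \<Rightarrow> 'c" where
  "fq_embed \<iota> c = \<iota> (Fract [:c:] 1)"

definition eval_theta :: "('f::{field,finite} poly fract \<Rightarrow> 'c::field) \<Rightarrow> 'f poly \<Rightarrow> 'c" where
  "eval_theta \<iota> a = poly (map_poly (fq_embed \<iota>) a) (theta \<iota>)"


section \<open>Twisted power series\<close>

text \<open>
  A sequence \<open>P\<close> of \<open>d \<times> d\<close> matrices stands for \<open>\<Sum>n. P n \<tau>\<^sup>n\<close>, where \<open>\<tau>\<close> is the \<open>q\<close>-th power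
  Frobenius; the multiplication rule is \<open>\<tau> M = M\<^sup>(\<^sup>q\<^sup>) \<tau>\<close>.
\<close>

type_synonym 'c twisted = "nat \<Rightarrow> 'c mat"

definition tw_const :: "nat \<Rightarrow> 'c::field mat \<Rightarrow> 'c twisted" where
  "tw_const d M = (\<lambda>n. if n = 0 then M else 0\<^sub>m d d)"

definition tw_mult :: "nat \<Rightarrow> nat \<Rightarrow> 'c::field twisted \<Rightarrow> 'c twisted \<Rightarrow> 'c twisted" where
  "tw_mult q d P Q = (\<lambda>n. mat d d (\<lambda>(i, j).
     \<Sum>m\<le>n. (P m * map_mat (\<lambda>x. x ^ (q ^ m)) (Q (n - m))) $$ (i, j)))"

definition tw_power :: "nat \<Rightarrow> nat \<Rightarrow> 'c::field twisted \<Rightarrow> nat \<Rightarrow> 'c twisted" where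
  "tw_power q d P k = (tw_mult q d P ^^ k) (tw_const d (1\<^sub>m d))"

text \<open>For a polynomial in \<open>\<tau>\<close> the series below is a finite sum.\<close>

definition tw_eval ::
    "nat \<Rightarrow> nat \<Rightarrow> 'c::{field,metric_space} twisted \<Rightarrow> 'c vec \<Rightarrow> 'c vec" where
  "tw_eval q d P x = vec d (\<lambda>i. \<Sum>n. (P n *\<^sub>v map_vec (\<lambda>y. y ^ (q ^ n)) x) $ i)"


section \<open>The \<open>t\<close>-module and its special point\<close>

text \<open>
  Blocks, like list and matrix positions, are numbered from \<open>0\<close>: block \<open>l\<close> has length
  \<open>blk_dim s l = s\<^sub>l + \<dots> + s\<^sub>r\<^sub>-\<^sub>1\<close> and occupies the positions from \<open>blk_start s l\<close> to \<open>blk_last s l\<close>.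
\<close>

definition blk_dim :: "nat list \<Rightarrow> nat \<Rightarrow> nat" where
  "blk_dim s l = sum_list (drop l s)"

definition blk_start :: "nat list \<Rightarrow> nat \<Rightarrow> nat" where
  "blk_start s l = (\<Sum>m<l. blk_dim s m)"

definition blk_last :: "nat list \<Rightarrow> nat \<Rightarrow> nat" where
  "blk_last s l = blk_start s l + blk_dim s l - 1"

definition tot_dim :: "nat list \<Rightarrow> nat" where
  "tot_dim s = (\<Sum>l<length s. blk_dim s l)"

definition N_mat :: "nat list \<Rightarrow> 'c::field mat" where
  "N_mat s = diag_block_mat
     (map (\<lambda>l. mat (blk_dim s l) (blk_dim s l) (\<lambda>(i, j). if j = Suc i then 1 else 0))
       [0..<length s])"

definition E_mat :: "nat list \<Rightarrow> 'c::field list \<Rightarrow> 'c mat" where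
  "E_mat s u = mat (tot_dim s) (tot_dim s) (\<lambda>(i, j).
     \<Sum>l<length s. \<Sum>m\<in>{l..<length s}.
       if i = blk_last s l \<and> j = blk_start s m
       then (- 1) ^ (m - l) * (\<Prod>e\<in>{l..<m}. u ! e) else 0)"

definition special_point :: "nat list \<Rightarrow> 'c::field list \<Rightarrow> 'c vec" where
  "special_point s u = vec (tot_dim s) (\<lambda>i.
     \<Sum>l<length s. if i = blk_last s l
       then (- 1) ^ (length s - 1 - l) * (\<Prod>e\<in>{l..<length s}. u ! e) else 0)"

definition rho_t ::
    "('f::{field,finite} poly fract \<Rightarrow> 'c::field) \<Rightarrow> nat list \<Rightarrow> 'c list \<Rightarrow> 'c twisted" where
  "rho_t \<iota> s u = (\<lambda>n.
     if n = 0 then theta \<iota> \<cdot>\<^sub>m 1\<^sub>m (tot_dim s) + N_mat s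
     else if n = 1 then E_mat s u
     else 0\<^sub>m (tot_dim s) (tot_dim s))"

definition rho ::
    "('f::{field,finite} poly fract \<Rightarrow> 'c::field) \<Rightarrow> nat list \<Rightarrow> 'c list \<Rightarrow> 'f poly \<Rightarrow> 'c twisted" where
  "rho \<iota> s u a = (\<lambda>n. mat (tot_dim s) (tot_dim s) (\<lambda>(i, j).
     \<Sum>k\<le>degree a. fq_embed \<iota> (coeff a k) *
       tw_power CARD('f) (tot_dim s) (rho_t \<iota> s u) k n $$ (i, j)))"

definition rho_point ::
    "('f::{field,finite} poly fract \<Rightarrow> 'c::{field,metric_space}) \<Rightarrow> nat list \<Rightarrow> 'c list \<Rightarrow> 'f poly \<Rightarrow> 'c vec"
  where
  "rho_point \<iota> s u a = tw_eval CARD('f) (tot_dim s) (rho \<iota> s u a) (special_point s u)"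

definition log_coeffs ::
    "('f::{field,finite} poly fract \<Rightarrow> 'c::field) \<Rightarrow> nat list \<Rightarrow> 'c list \<Rightarrow> 'c twisted" where
  "log_coeffs \<iota> s u = (THE P.
     (\<forall>n. P n \<in> carrier_mat (tot_dim s) (tot_dim s)) \<and>
     P 0 = 1\<^sub>m (tot_dim s) \<and>
     (\<forall>a::'f poly.
        tw_mult CARD('f) (tot_dim s) P (rho \<iota> s u a) =
        tw_mult CARD('f) (tot_dim s) (tw_const (tot_dim s) (rho \<iota> s u a 0)) P))"

definition log_G ::
    "('f::{field,finite} poly fract \<Rightarrow> 'c::{field,metric_space}) \<Rightarrow> nat list \<Rightarrow> 'c list \<Rightarrow> 'c vec \<Rightarrow> 'c vec"
  where
  "log_G \<iota> s u x = tw_eval CARD('f) (tot_dim s) (log_coeffs \<iota> s u) x"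

definition G_max_ideal :: "nat list \<Rightarrow> 'c::{field,metric_space} vec set" where
  "G_max_ideal s = {x \<in> carrier_vec (tot_dim s). \<forall>i<tot_dim s. x $ i \<in> max_ideal}"


section \<open>\<open>v\<close>-adic Carlitz multiple star polylogarithms\<close>

text \<open>
  The value does not depend on the choice of \<open>a\<close>.  The coordinate with number \<open>blk_dim (rev s) 0\<close>
  in the usual counting has position \<open>blk_dim (rev s) 0 - 1\<close>.  Zero arguments are allowed.
\<close>

definition Li_star ::
    "('f::{field,finite} poly fract \<Rightarrow> 'c::{field,metric_space}) \<Rightarrow> nat list \<Rightarrow> 'c list \<Rightarrow> 'c" where
  "Li_star \<iota> s u =
     (if s = [] then 0
      else let a = (SOME a. a \<noteq> 0 \<and> rho_point \<iota> (rev s) (rev u) a \<in> G_max_ideal (rev s))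
        in (- 1) ^ (length s - 1) / eval_theta \<iota> a *
           log_G \<iota> (rev s) (rev u) (rho_point \<iota> (rev s) (rev u) a) $ (blk_dim (rev s) 0 - 1))"

definition merge_index :: "nat \<Rightarrow> nat list \<Rightarrow> nat list" where
  "merge_index i s =
     (if 1 \<le> i \<and> i \<le> length s then sum_list (take i s) # drop i s else [])"

end

theory Submission
  imports Defs
begin

text \<open>
  Only the last row \<open>w\<^sub>n\<close> of the first block of the logarithm coefficients matters.  As \<open>N\<close> kills
  this row from the left, the functional equation for \<open>\<rho>\<^sub>t\<close> becomes
  \<open>w\<^sub>n ([n] + N) = - w\<^sub>n\<^sub>-\<^sub>1 E\<^sup>(\<^sup>n\<^sup>-\<^sup>1\<^sup>)\<close>, so within block \<open>m\<close> the entry \<open>j\<close> places before the last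
  is \<open>(-[n])\<^sup>j\<close> times the last entry \<open>y\<^sub>n(m)\<close>.  Expanding \<open>(\<theta> - \<theta>\<^bsup>q^n\<^esup>)\<^sup>j\<close> binomially writes the
  logarithm coordinate through the series \<open>F\<^sub>m(x) = \<Sum>n. y\<^sub>n(m) x\<^bsup>q^n\<^esup>\<close>.

  The values \<open>y\<^sub>n(m)\<close> depend only on the block lengths up to \<open>m\<close> and the arguments before \<open>m\<close>.
  Merging the tail of the index keeps these block lengths, so both polylogarithms of the \<open>m\<close>-th
  summand are, up to sign, sums of the same \<open>F\<^sub>l\<close> at special points whose coordinates differ
  by a sign; in their difference everything but \<open>F\<^sub>m(x)\<close> cancels.

  That the choice of \<open>a\<close> is irrelevant follows from the functional equation of the row on the
  points with coordinates in the maximal ideal; convergence there holds because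
  \<open>\<theta>\<^bsup>q^n\<^esup> - \<theta>\<close> is squarefree, which bounds its absolute value from below.
\<close>

section \<open>Finite fields and Frobenius\<close>

text \<open>Multiplication by a nonzero x permutes the nonzero elements, so comparing the product of
  all of them before and after gives x^(q-1) = 1.\<close>

lemma power_card_field_eq_self:
  fixes x :: "'f::{field,finite}"
  shows "x ^ CARD('f) = x"
proof (cases "x = 0")
  case True
  then show ?thesis by (simp add: power_0_left)
next
  case False
  let ?U = "UNIV - {0 :: 'f}"
  have "inj_on ((*) x) ?U" using False by (auto intro: inj_onI)
  moreover have "(*) x ` ?U \<subseteq> ?U" using False by auto
  ultimately have "bij_betw ((*) x) ?U ?U" by (simp add: bij_betw_def endo_inj_surj)
  then have "prod id ?U = (\<Prod>y\<in>?U. x * y)" by (subst prod.reindex_bij_betw[symmetric]) auto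
  also have "\<dots> = x ^ card ?U * prod id ?U" by (simp add: prod.distrib)
  finally have one: "x ^ card ?U = 1" by simp
  have "Suc (card ?U) = CARD('f)" by (rule card_Suc_Diff1) auto
  then have "x ^ CARD('f) = x * x ^ card ?U" by (metis power_Suc)
  then show ?thesis unfolding one by simp
qed

lemma card_field_ge_2: "CARD('f::{field,finite}) \<ge> 2"
proof -
  have "card {0, 1 :: 'f} \<le> CARD('f)" by (rule card_mono) auto
  then show ?thesis by simp
qed

text \<open>The polynomial \<open>(X + 1)\<^sup>q - X\<^sup>q - 1\<close> has degree below \<open>q\<close> and vanishes on the
  whole field, so it is zero.\<close>

lemma binomial_card_field_eq_0:
  assumes "0 < i" "i < CARD('f::{field,finite})"
  shows "of_nat (CARD('f) choose i) = (0::'f)"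
proof -
  let ?q = "CARD('f)"
  define p :: "'f poly" where "p = (\<Sum>i\<in>{1..<?q}. monom (of_nat (?q choose i)) i)"
  have deg: "degree p \<le> ?q - 1"
    unfolding p_def
    by (rule degree_sum_le) (auto intro!: order.trans[OF degree_monom_le])
  have "poly p x = 0" for x
  proof -
    have "(x + 1) ^ ?q = (\<Sum>k\<le>?q. of_nat (?q choose k) * x ^ k)"
      by (simp add: binomial_ring)
    also have "{..?q} = insert 0 (insert ?q {1..<?q})"
      using card_field_ge_2[where 'f='f] by auto
    also have "(\<Sum>k\<in>\<dots>. of_nat (?q choose k) * x ^ k) = 1 + (x ^ ?q + poly p x)"
      using card_field_ge_2[where 'f='f] by (simp add: p_def poly_sum poly_monom)
    finally show ?thesis
      by (simp add: power_card_field_eq_self)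
  qed
  then have roots: "{x. poly p x = 0} = UNIV" by auto
  have "p = 0"
  proof (rule ccontr)
    assume "p \<noteq> 0"
    from card_poly_roots_bound[OF this] deg show False
      using roots card_field_ge_2[where 'f='f] by simp
  qed
  moreover have "coeff p i = of_nat (?q choose i)"
    using assms by (simp add: p_def coeff_sum)
  ultimately show ?thesis by simp
qed

text \<open>The derivative of X^(q^n) - X is -1, because q = 0 in the field, and a square factor v^2
  would force v to divide it. This yields a lower bound for the absolute value of [n] that is
  uniform in n.\<close>

lemma square_not_dvd_power_minus_X:
  fixes v :: "'f::{field,finite} poly"
  assumes "irreducible v" "n > 0"
  shows "\<not> v ^ 2 dvd [:0, 1:] ^ (CARD('f) ^ n) - [:0, 1:]"
proof
  let ?q = "CARD('f)"
  assume "v ^ 2 dvd [:0, 1:] ^ (?q ^ n) - [:0, 1:]"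
  then obtain w where w: "[:0, 1:] ^ (?q ^ n) - [:0, 1:] = v ^ 2 * w" by (auto simp: dvd_def)
  \<comment> \<open>The binomial coefficient for i = 1 is q itself, so its vanishing says that q = 0
    in the field.\<close>
  have "of_nat (?q choose 1) = (0 :: 'f)"
    by (rule binomial_card_field_eq_0) (use card_field_ge_2[where 'f='f] in auto)
  then have "of_nat (?q ^ n) = (0 :: 'f)" using assms(2) by simp
  then have "pderiv ([:0, 1:] ^ (?q ^ n) - [:0, 1:] :: 'f poly) = [:-1:]"
    by (simp add: pderiv_diff pderiv_power pderiv_pCons one_pCons del: of_nat_power)
  moreover have "v dvd pderiv (v ^ 2 * w)"
    by (simp add: pderiv_mult power2_eq_square)
  ultimately have "v dvd [:-1:]" using w by simp
  then have "v dvd 1"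
    using dvd_minus_iff[of v 1] by (simp add: one_pCons)
  with assms(1) show False by (simp add: irreducible_def)
qed

section \<open>The valued field\<close>

context v_adic_complex_field
begin

sublocale \<iota>: field_hom \<iota> by (rule field_hom_\<iota>)

lemma Fract_of_nat: "Fract (of_nat n) 1 = (of_nat n :: 'f poly fract)"
  by (simp add: of_nat_fract)

text \<open>Carries the vanishing of the inner binomial coefficients from the finite field to
  \<complex>\<open>\<^sub>v\<close>, which makes q-th powering additive there.\<close>

lemma of_nat_image_eq_0:
  assumes "of_nat n = (0::'f)" shows "of_nat n = (0::'c)"
proof -
  have "of_nat n = (0 :: 'f poly)" using assms by (simp add: of_nat_poly)
  then have "\<iota> (of_nat n) = \<iota> 0" by (simp only: Zero_fract_def flip: Fract_of_nat)
  then show ?thesis by (simp only: \<iota>.hom_zero \<iota>.hom_of_nat)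
qed

lemma frob_add1: "(x + y :: 'c) ^ CARD('f) = x ^ CARD('f) + y ^ CARD('f)"
proof -
  have "(x + y) ^ CARD('f) = (\<Sum>k\<le>CARD('f). of_nat (CARD('f) choose k) * x ^ k * y ^ (CARD('f) - k))"
    by (rule binomial_ring)
  also have "\<dots> = (\<Sum>k\<in>{0,CARD('f)}. of_nat (CARD('f) choose k) * x ^ k * y ^ (CARD('f) - k))"
    by (rule sum.mono_neutral_right) (auto simp: of_nat_image_eq_0 binomial_card_field_eq_0)
  finally show ?thesis using card_field_ge_2[where 'f='f] by simp
qed

lemma frob_add: "(x + y :: 'c) ^ (CARD('f) ^ n) = x ^ (CARD('f) ^ n) + y ^ (CARD('f) ^ n)"
proof (induction n)
  case (Suc n)
  then show ?case by (simp add: power_mult power_Suc2 frob_add1 del: power_Suc)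
qed simp

text \<open>Deduced from additivity at x and -x, so odd and even q need not be
  distinguished.\<close>

lemma frob_minus: "(- x :: 'c) ^ (CARD('f) ^ n) = - (x ^ (CARD('f) ^ n))"
proof -
  have "x ^ (CARD('f) ^ n) + (- x) ^ (CARD('f) ^ n) = 0"
    using frob_add[of x "- x" n] by (simp add: power_0_left)
  then show ?thesis by (simp add: eq_neg_iff_add_eq_0 add.commute)
qed

lemma frob_sum: "(sum f I :: 'c) ^ (CARD('f) ^ n) = (\<Sum>i\<in>I. f i ^ (CARD('f) ^ n))"
  by (induction I rule: infinite_finite_induct) (auto simp: frob_add)

lemma frob_fq: "fq_embed \<iota> c ^ (CARD('f) ^ n) = fq_embed \<iota> c"
proof -
  have pow: "fq_embed \<iota> c ^ k = fq_embed \<iota> (c ^ k)" for k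
  proof (induction k)
    case 0
    show ?case by (simp add: fq_embed_def flip: One_fract_def one_pCons)
  next
    case (Suc k)
    have "Fract [:c:] 1 * Fract [:c ^ k:] 1 = (Fract [:c ^ Suc k:] 1 :: 'f poly fract)"
      by (simp add: mult.commute)
    then show ?case using Suc by (simp only: fq_embed_def power_Suc flip: \<iota>.hom_mult)
  qed
  show ?thesis
  proof (induction n)
    case (Suc n)
    then show ?case by (simp add: power_mult power_Suc2 pow power_card_field_eq_self del: power_Suc)
  qed simp
qed

subsection \<open>The absolute value\<close>

lemma absv_0 [simp]: "absv (0::'c) = 0" by (simp add: absv_def)

lemma absv_nonneg [simp]: "absv (x::'c) \<ge> 0" by (simp add: absv_def)

lemma absv_eq_0 [simp]: "absv (x::'c) = 0 \<longleftrightarrow> x = 0" by (simp add: absv_def)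

lemma absv_1 [simp]: "absv (1::'c) = 1"
proof -
  have "absv (1::'c) * absv (1::'c) = absv (1::'c) * 1" using absv_mult[of 1 1] by simp
  then show ?thesis unfolding mult_cancel_left by simp
qed

lemma absv_power: "absv ((x::'c) ^ n) = absv x ^ n"
  by (induction n) (auto simp: absv_mult)

lemma absv_minus [simp]: "absv (- x :: 'c) = absv x"
  by (metis absv_def diff_0 diff_zero dist_absv dist_commute)

lemma absv_inverse: "absv (inverse (x::'c)) = inverse (absv x)"
proof (cases "x = 0")
  case False
  then have "absv (inverse x) * absv x = 1" by (simp flip: absv_mult)
  then show ?thesis using inverse_unique[of "absv x" "absv (inverse x)"] by (simp add: mult.commute)
qed simp

lemma absv_sum_le:
  assumes "\<And>i. i \<in> I \<Longrightarrow> absv (f i :: 'c) \<le> B" "B \<ge> 0"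
  shows "absv (sum f I) \<le> B"
  using assms(1)
proof (induction I rule: infinite_finite_induct)
  case (insert x F)
  have "absv (f x + sum f F) \<le> max (absv (f x)) (absv (sum f F))" by (rule absv_ultrametric)
  also have "\<dots> \<le> B" using insert by auto
  finally show ?case using insert by simp
qed (use assms(2) in auto)

lemma absv_sum_less:
  assumes "\<And>i. i \<in> I \<Longrightarrow> absv (f i :: 'c) < B" "B > 0"
  shows "absv (sum f I) < B"
  using assms(1)
proof (induction I rule: infinite_finite_induct)
  case (insert x F)
  have "absv (f x + sum f F) \<le> max (absv (f x)) (absv (sum f F))" by (rule absv_ultrametric)
  also have "\<dots> < B" using insert by auto
  finally show ?case using insert by simp
qed (use assms(2) in auto)

lemma absv_prod: "absv (prod f I :: 'c) = (\<Prod>i\<in>I. absv (f i))"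
  by (induction I rule: infinite_finite_induct) (auto simp: absv_mult)

lemma absv_triangle: "absv (x + y :: 'c) \<le> absv x + absv y"
  using absv_ultrametric[of x y] absv_nonneg[of x] absv_nonneg[of y] by linarith

lemma v_not_unit: "\<not> v dvd 1"
  using v_irreducible by (auto simp: irreducible_def)

lemma v_order_1: "v_order v 1 = 0"
proof -
  have "{n. v ^ n dvd 1} = {0}"
    using v_not_unit by (auto simp: dvd_power_le is_unit_power_iff)
  then show ?thesis by (simp add: v_order_def)
qed

lemma absv_\<iota>_poly:
  "a \<noteq> 0 \<Longrightarrow> absv (\<iota> (Fract a 1)) = real CARD('f) powi (- int (degree v * v_order v a))"
  by (simp add: absv_\<iota> v_order_1)

lemma absv_\<iota>_poly_le: "absv (\<iota> (Fract a 1)) \<le> 1"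
proof (cases "a = 0")
  case True
  then show ?thesis by (simp flip: Zero_fract_def)
next
  case False
  then show ?thesis using card_field_ge_2[where 'f='f]
    by (simp add: absv_\<iota>_poly power_int_minus inverse_le_1_iff)
qed

lemma absv_theta_le: "absv (theta \<iota>) \<le> 1"
  unfolding theta_def by (rule absv_\<iota>_poly_le)

text \<open>Evaluation at \<theta> is the restriction of the structure map to polynomials. It is
  therefore injective, and division by a(\<theta>) is meaningful for nonzero a.\<close>

lemma eval_theta_eq: "eval_theta \<iota> a = \<iota> (Fract a 1)"
proof -
  have z: "fq_embed \<iota> 0 = 0" by (simp add: fq_embed_def flip: Zero_fract_def)
  show ?thesis
  proof (induction a)
    case 0
    then show ?case by (simp add: eval_theta_def flip: Zero_fract_def)
  next
    case (pCons c p)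
    have "eval_theta \<iota> (pCons c p) = fq_embed \<iota> c + theta \<iota> * eval_theta \<iota> p"
      by (simp add: eval_theta_def map_poly_pCons z)
    also have "\<dots> = \<iota> (Fract [:c:] 1 + Fract [:0, 1:] 1 * Fract p 1)"
      by (simp only: pCons.IH fq_embed_def theta_def \<iota>.hom_add \<iota>.hom_mult)
    also have "Fract [:c:] 1 + Fract [:0, 1:] 1 * Fract p 1 = Fract (pCons c p) 1"
      by simp
    finally show ?case .
  qed
qed

lemma eval_theta_nonzero: "a \<noteq> 0 \<Longrightarrow> eval_theta \<iota> a \<noteq> 0"
  by (simp add: eval_theta_eq Zero_fract_def eq_fract)

lemma eval_theta_1: "eval_theta \<iota> 1 = 1"
  by (simp add: eval_theta_eq flip: One_fract_def)

lemma eval_theta_sum: "eval_theta \<iota> a = (\<Sum>k\<le>degree a. fq_embed \<iota> (coeff a k) * theta \<iota> ^ k)"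
proof -
  have z: "fq_embed \<iota> 0 = 0" by (simp add: fq_embed_def flip: Zero_fract_def)
  have co: "coeff (map_poly (fq_embed \<iota>) a) k = fq_embed \<iota> (coeff a k)" for k
    by (simp add: coeff_map_poly z)
  have "degree (map_poly (fq_embed \<iota>) a) \<le> degree a"
    by (rule degree_le) (simp add: co z coeff_eq_0)
  then have "(\<Sum>k\<le>degree (map_poly (fq_embed \<iota>) a).
        coeff (map_poly (fq_embed \<iota>) a) k * theta \<iota> ^ k)
      = (\<Sum>k\<le>degree a. coeff (map_poly (fq_embed \<iota>) a) k * theta \<iota> ^ k)"
    by (intro sum.mono_neutral_left) (auto simp: coeff_eq_0)
  then show ?thesis unfolding eval_theta_def poly_altdef co .
qed

definition bracket :: "nat \<Rightarrow> 'c" where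
  "bracket i = theta \<iota> ^ (CARD('f) ^ i) - theta \<iota>"

lemma bracket_0 [simp]: "bracket 0 = 0" by (simp add: bracket_def)

lemma bracket_eq: "bracket i = \<iota> (Fract ([:0, 1:] ^ (CARD('f) ^ i) - [:0, 1:]) 1)"
proof -
  have "Fract a 1 ^ k = Fract (a ^ k) 1" for a :: "'f poly" and k
    by (induction k) (auto simp: One_fract_def)
  then have "\<iota> (Fract ([:0, 1:] ^ (CARD('f) ^ i)) 1) = theta \<iota> ^ (CARD('f) ^ i)"
    by (metis theta_def \<iota>.hom_power)
  moreover have "Fract ([:0, 1:] ^ (CARD('f) ^ i) - [:0, 1:]) 1
      = Fract ([:0, 1:] ^ (CARD('f) ^ i)) 1 - (Fract [:0, 1:] 1 :: 'f poly fract)" by simp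
  ultimately show ?thesis by (simp only: bracket_def theta_def \<iota>.hom_minus)
qed

lemma absv_bracket_le: "absv (bracket i) \<le> 1"
  unfolding bracket_eq by (rule absv_\<iota>_poly_le)

text \<open>As X^(q^i) - X is squarefree, v divides it at most once. The bound is independent of i,
  so inverting brackets makes the logarithm coefficients grow at most exponentially in n.\<close>

lemma absv_bracket_ge:
  assumes "i > 0"
  shows "inverse (real CARD('f) ^ degree v) \<le> absv (bracket i)"
proof -
  let ?p = "[:0, 1:] ^ (CARD('f) ^ i) - [:0, 1 :: 'f:]"
  have ndvd: "\<not> v ^ 2 dvd ?p"
    by (rule square_not_dvd_power_minus_X[OF v_irreducible assms])
  \<comment> \<open>Zero is divisible by v^2, so non-divisibility already excludes the zero
    polynomial.\<close>
  then have nz: "?p \<noteq> 0" by (metis dvd_0_right)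
  \<comment> \<open>The inclusion also gives finiteness of the set, on which the meaning of
    \<open>Max\<close> in \<open>v_order\<close> rests.\<close>
  have "{n. v ^ n dvd ?p} \<subseteq> {0, 1}"
  proof
    fix n assume "n \<in> {n. v ^ n dvd ?p}"
    then have "v ^ n dvd ?p" by simp
    with ndvd have "\<not> 2 \<le> n" by (meson dvd_trans le_imp_power_dvd)
    then show "n \<in> {0, 1}" by auto
  qed
  moreover have "0 \<in> {n. v ^ n dvd ?p}" by simp
  ultimately have "v_order v ?p \<le> 1"
    unfolding v_order_def by (subst Max_le_iff) (auto intro: finite_subset exI[of _ 0])
  then have le: "degree v * v_order v ?p \<le> degree v" by simp
  have "real CARD('f) ^ (degree v * v_order v ?p) \<le> real CARD('f) ^ degree v"
    by (rule power_increasing[OF le]) (use card_field_ge_2[where 'f='f] in auto)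
  then show ?thesis
    unfolding bracket_eq absv_\<iota>_poly[OF nz] power_int_minus power_int_of_nat
    using card_field_ge_2[where 'f='f] by (intro le_imp_inverse_le) auto
qed

lemma bracket_nonzero: "i > 0 \<Longrightarrow> bracket i \<noteq> 0"
proof
  assume "i > 0" "bracket i = 0"
  with absv_bracket_ge[of i] have "inverse (real CARD('f) ^ degree v) \<le> 0" by simp
  moreover have "real CARD('f) ^ degree v > 0" by simp
  ultimately show False by (simp add: not_le)
qed

subsection \<open>Convergence\<close>

text \<open>The type class of the field supplies only a metric, so continuity of addition and of
  scaling is obtained from real limits of absolute values.\<close>

lemma tendsto_iff_absv: "(f \<longlongrightarrow> (l::'c)) F \<longleftrightarrow> ((\<lambda>n. absv (f n - l)) \<longlongrightarrow> 0) F"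
  by (subst tendsto_dist_iff) (simp add: dist_absv)

lemma tendsto_add_c:
  assumes "(f \<longlongrightarrow> (a::'c)) F" "(g \<longlongrightarrow> b) F"
  shows "((\<lambda>n. f n + g n) \<longlongrightarrow> a + b) F"
proof -
  have "((\<lambda>n. absv (f n - a) + absv (g n - b)) \<longlongrightarrow> 0 + 0) F"
    using assms unfolding tendsto_iff_absv by (intro tendsto_add)
  then have *: "((\<lambda>n. absv (f n - a) + absv (g n - b)) \<longlongrightarrow> 0) F" by simp
  show ?thesis
    unfolding tendsto_iff_absv[where l="a+b"]
  proof (rule tendsto_sandwich[OF _ _ tendsto_const *])
    show "\<forall>\<^sub>F n in F. absv (f n + g n - (a + b)) \<le> absv (f n - a) + absv (g n - b)"
      using absv_triangle[of "f n - a" "g n - b" for n]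
      by (intro always_eventually allI) (simp add: algebra_simps)
  qed simp
qed

lemma tendsto_mult_left_c:
  assumes "(f \<longlongrightarrow> (a::'c)) F"
  shows "((\<lambda>n. c * f n) \<longlongrightarrow> c * a) F"
proof -
  have "((\<lambda>n. absv c * absv (f n - a)) \<longlongrightarrow> absv c * 0) F"
    using assms unfolding tendsto_iff_absv by (intro tendsto_mult tendsto_const)
  then show ?thesis
    unfolding tendsto_iff_absv[where l="c*a"] by (simp flip: right_diff_distrib add: absv_mult)
qed

lemma sums_add_c: "(f::nat \<Rightarrow> 'c) sums a \<Longrightarrow> g sums b \<Longrightarrow> (\<lambda>n. f n + g n) sums (a + b)"
  unfolding sums_def sum.distrib by (rule tendsto_add_c)

lemma sums_mult_c: "(f::nat \<Rightarrow> 'c) sums a \<Longrightarrow> (\<lambda>n. c * f n) sums (c * a)"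
  unfolding sums_def sum_distrib_left[symmetric] by (rule tendsto_mult_left_c)

lemma sums_sum_c:
  assumes "\<And>i. i \<in> I \<Longrightarrow> (f i::nat \<Rightarrow> 'c) sums a i"
  shows "(\<lambda>n. \<Sum>i\<in>I. f i n) sums (\<Sum>i\<in>I. a i)"
  using assms
  by (induction I rule: infinite_finite_induct) (auto intro!: sums_add_c)

text \<open>In a complete ultrametric field a series converges once its terms tend to 0: a
  difference of two partial sums is no larger than the largest term between them.\<close>

lemma summable_c:
  assumes "(\<lambda>n. absv (f n :: 'c)) \<longlonglongrightarrow> 0"
  shows "summable f"
proof -
  have "Cauchy (\<lambda>n. \<Sum>i<n. f i)"
  proof (rule metric_CauchyI)
    fix e :: real assume "e > 0"
    with assms obtain N where N: "\<And>n. n \<ge> N \<Longrightarrow> absv (f n) < e"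
      by (auto simp: LIMSEQ_iff)
    have *: "dist (\<Sum>i<m. f i) (\<Sum>i<n. f i) < e" if "N \<le> m" "m \<le> n" for m n
    proof -
      have "dist (\<Sum>i<m. f i) (\<Sum>i<n. f i) = absv ((\<Sum>i<n. f i) - (\<Sum>i<m. f i))"
        by (subst dist_commute) (rule dist_absv)
      also have "(\<Sum>i<n. f i) - (\<Sum>i<m. f i) = (\<Sum>i\<in>{m..<n}. f i)"
        using sum_diff_nat_ivl[of 0 m n f] that by (simp add: atLeast0LessThan)
      also have "absv \<dots> < e"
        using that N \<open>e > 0\<close> by (intro absv_sum_less) auto
      finally show ?thesis .
    qed
    show "\<exists>M. \<forall>m\<ge>M. \<forall>n\<ge>M. dist (\<Sum>i<m. f i) (\<Sum>i<n. f i) < e"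
    proof (intro exI[of _ N] allI impI)
      fix m n assume "N \<le> m" "N \<le> n"
      then show "dist (\<Sum>i<m. f i) (\<Sum>i<n. f i) < e"
        using *[of m n] *[of n m] by (cases "m \<le> n") (auto simp: dist_commute)
    qed
  qed
  then show ?thesis
    by (simp add: Cauchy_convergent_iff summable_iff_convergent)
qed

end

text \<open>Fix m with K \<rho>^m < 1/2. Since q^i eventually exceeds m i, the sequence is
  eventually bounded by (1/2)^i.\<close>

lemma power_times_double_exp_power_tendsto_0:
  fixes K \<rho> :: real
  assumes "0 \<le> \<rho>" "\<rho> < 1" "K \<ge> 0" "q \<ge> 2"
  shows "(\<lambda>i. K ^ i * \<rho> ^ (q ^ i)) \<longlonglongrightarrow> 0"
proof -
  obtain m where m: "K * \<rho> ^ m < 1 / 2"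
  proof -
    have "(\<lambda>m. K * \<rho> ^ m) \<longlonglongrightarrow> K * 0"
      using assms by (intro tendsto_mult tendsto_const LIMSEQ_power_zero) auto
    then have "\<forall>\<^sub>F m in sequentially. K * \<rho> ^ m < 1 / 2"
      by (intro order_tendstoD(2)) auto
    then show ?thesis using that by (auto simp: eventually_sequentially)
  qed
  have ev: "\<forall>\<^sub>F i in sequentially. m * i \<le> q ^ i"
  proof -
    have "\<forall>\<^sub>F i::nat in sequentially. real m * real i / 2 ^ i < 1"
    proof (rule order_tendstoD(2))
      show "(\<lambda>i. real m * real i / 2 ^ i) \<longlonglongrightarrow> real m * 0"
        using tendsto_mult[OF tendsto_const[of "real m"] lim_n_over_pown[of "2::real"]] by simp
    qed simp
    then show ?thesis
    proof eventually_elim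
      case (elim i)
      then have "real (m * i) < real (2 ^ i)" by (simp add: field_simps)
      then have "m * i \<le> 2 ^ i" by linarith
      also have "\<dots> \<le> q ^ i" using assms(4) by (rule power_mono) simp
      finally show ?case .
    qed
  qed
  show ?thesis
  proof (rule tendsto_sandwich[OF _ _ tendsto_const])
    show "\<forall>\<^sub>F i in sequentially. K ^ i * \<rho> ^ (q ^ i) \<le> (1 / 2) ^ i"
      using ev
    proof eventually_elim
      case (elim i)
      have "K ^ i * \<rho> ^ (q ^ i) \<le> K ^ i * \<rho> ^ (m * i)"
        using assms elim by (intro mult_left_mono power_decreasing) auto
      also have "\<dots> = (K * \<rho> ^ m) ^ i" by (simp add: power_mult power_mult_distrib)
      also have "\<dots> \<le> (1 / 2) ^ i" using m assms by (intro power_mono) auto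
      finally show ?case .
    qed
    show "(\<lambda>i. (1 / 2 :: real) ^ i) \<longlonglongrightarrow> 0" by (rule LIMSEQ_power_zero) simp
  qed (use assms in auto)
qed

section \<open>Twisted power series\<close>

lemma tw_mult_carrier [simp]: "tw_mult Q d P R n \<in> carrier_mat d d"
  by (simp add: tw_mult_def)

lemma tw_mult_index:
  assumes "\<And>n. P n \<in> carrier_mat d d" "\<And>n. R n \<in> carrier_mat d d" "i < d" "j < d"
  shows "tw_mult Q d P R n $$ (i, j)
    = (\<Sum>m\<le>n. \<Sum>k<d. P m $$ (i, k) * (R (n - m) $$ (k, j)) ^ (Q ^ m))"
proof -
  have "(P m * map_mat (\<lambda>x. x ^ (Q ^ m)) (R (n - m))) $$ (i, j)
      = (\<Sum>k<d. P m $$ (i, k) * (R (n - m) $$ (k, j)) ^ (Q ^ m))" for m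
    using assms(1)[of m] assms(2)[of "n - m"] assms(3,4)
    by (auto simp: scalar_prod_def lessThan_atLeast0 intro!: sum.cong)
  then show ?thesis using assms(3,4) by (simp add: tw_mult_def)
qed

lemma tw_const_carrier [simp]: "M \<in> carrier_mat d d \<Longrightarrow> tw_const d M n \<in> carrier_mat d d"
  by (simp add: tw_const_def)

lemma twisted_eqI:
  assumes "\<And>n. P n \<in> carrier_mat d d" "\<And>n. R n \<in> carrier_mat d d"
    and "\<And>n i j. i < d \<Longrightarrow> j < d \<Longrightarrow> P n $$ (i, j) = R n $$ (i, j)"
  shows "P = R"
proof
  fix n
  show "P n = R n" by (rule eq_matI) (use assms(1,2)[of n] assms(3)[of _ _ n] in auto)
qed

lemma tw_mult_const_index:
  assumes "M \<in> carrier_mat d d" "\<And>n. R n \<in> carrier_mat d d" "i < d" "j < d"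
  shows "tw_mult Q d (tw_const d M) R n $$ (i, j) = (\<Sum>k<d. M $$ (i, k) * R n $$ (k, j))"
proof -
  have "tw_mult Q d (tw_const d M) R n $$ (i, j) =
      (\<Sum>m\<le>n. \<Sum>k<d. tw_const d M m $$ (i, k) * (R (n - m) $$ (k, j)) ^ (Q ^ m))"
    by (rule tw_mult_index) (use assms in auto)
  also have "\<dots> = (\<Sum>m\<in>{0}. \<Sum>k<d. tw_const d M m $$ (i, k) * (R (n - m) $$ (k, j)) ^ (Q ^ m))"
    by (rule sum.mono_neutral_right) (use assms in \<open>auto simp: tw_const_def\<close>)
  finally show ?thesis by (simp add: tw_const_def)
qed

lemma tw_mult_one_left:
  assumes "\<And>n. R n \<in> carrier_mat d d"
  shows "tw_mult Q d (tw_const d (1\<^sub>m d)) R = R"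
proof (rule twisted_eqI[of _ d])
  fix n i j assume "i < d" "j < d"
  then have "tw_mult Q d (tw_const d (1\<^sub>m d)) R n $$ (i, j)
      = (\<Sum>k<d. (1\<^sub>m d) $$ (i, k) * R n $$ (k, j))"
    by (intro tw_mult_const_index) (use assms in auto)
  also have "\<dots> = (\<Sum>k<d. if k = i then R n $$ (k, j) else 0)"
    by (rule sum.cong) (use \<open>i < d\<close> in auto)
  also have "\<dots> = R n $$ (i, j)" using \<open>i < d\<close> by simp
  finally show "tw_mult Q d (tw_const d (1\<^sub>m d)) R n $$ (i, j) = R n $$ (i, j)" .
qed (use assms in auto)

text \<open>The entries of the identity matrix are fixed by the powers involved; Q > 0 ensures this
  for 0, as \<open>0 ^ 0\<close> is 1.\<close>

lemma tw_mult_one_right: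
  assumes "\<And>n. P n \<in> carrier_mat d d" "Q > 0"
  shows "tw_mult Q d P (tw_const d (1\<^sub>m d)) = P"
proof (rule twisted_eqI[of _ d])
  fix n i j assume ij: "i < d" "j < d"
  have "tw_mult Q d P (tw_const d (1\<^sub>m d)) n $$ (i, j) =
      (\<Sum>m\<le>n. \<Sum>k<d. P m $$ (i, k) * (tw_const d (1\<^sub>m d) (n - m) $$ (k, j)) ^ (Q ^ m))"
    by (rule tw_mult_index) (use assms ij in auto)
  also have "\<dots> = (\<Sum>m\<in>{n}. \<Sum>k<d. P m $$ (i, k) * (tw_const d (1\<^sub>m d) (n - m) $$ (k, j)) ^ (Q ^ m))"
    by (rule sum.mono_neutral_right) (use assms ij in \<open>auto simp: tw_const_def power_0_left\<close>)
  also have "\<dots> = (\<Sum>k<d. if k = j then P n $$ (i, k) else 0)"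
    by (subst sum.insert, simp, simp, subst sum.empty, subst add_0_right, rule sum.cong)
       (use ij assms(2) in \<open>auto simp: tw_const_def power_0_left\<close>)
  finally show "tw_mult Q d P (tw_const d (1\<^sub>m d)) n $$ (i, j) = P n $$ (i, j)" using ij by simp
qed (use assms in auto)

lemma tw_power_0: "tw_power Q d P 0 = tw_const d (1\<^sub>m d)"
  and tw_power_Suc: "tw_power Q d P (Suc k) = tw_mult Q d P (tw_power Q d P k)"
  by (auto simp: tw_power_def)

lemma tw_power_carrier [simp]: "tw_power Q d P k n \<in> carrier_mat d d"
  by (cases k) (auto simp: tw_power_0 tw_power_Suc)

lemma sum_triangle_split:
  fixes g :: "nat \<Rightarrow> nat \<Rightarrow> 'a::comm_monoid_add"
  shows "(\<Sum>m\<le>n. \<Sum>a\<le>m. g a (m - a)) = (\<Sum>a\<le>n. \<Sum>b\<le>n - a. g a b)"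
proof -
  have "(\<Sum>a\<le>n. \<Sum>b\<le>n - a. g a b) = (\<Sum>(a, b)\<in>(SIGMA a:{..n}. {..n - a}). g a b)"
    by (rule sum.Sigma) auto
  also have "(SIGMA a:{..n}. {..n - a}) = {(a, b). a + b \<le> n}" by auto
  finally show ?thesis by (simp add: sum.triangle_reindex_eq)
qed

section \<open>Associativity of the twisted multiplication\<close>

context v_adic_complex_field
begin

text \<open>Both bracketings are one sum over all a + b \<le> n. The outer power q^a passes through
  the inner sums because Frobenius is additive in this field.\<close>

lemma tw_mult_assoc:
  fixes P R S :: "'c twisted"
  assumes "\<And>n. P n \<in> carrier_mat d d" "\<And>n. R n \<in> carrier_mat d d" "\<And>n. S n \<in> carrier_mat d d"
  shows "tw_mult CARD('f) d (tw_mult CARD('f) d P R) S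
      = tw_mult CARD('f) d P (tw_mult CARD('f) d R S)"
proof (rule twisted_eqI[of _ d])
  fix n i j assume ij: "i < d" "j < d"
  let ?q = "CARD('f)"
  \<comment> \<open>The contribution of degree a from P, degree b from R and the remaining degree
    from S.\<close>
  define g where "g a b = (\<Sum>h<d. \<Sum>k<d. P a $$ (i, h) * (R b $$ (h, k)) ^ (?q ^ a) *
      (S (n - (a + b)) $$ (k, j)) ^ (?q ^ (a + b)))" for a b
  have "tw_mult ?q d (tw_mult ?q d P R) S n $$ (i, j) = (\<Sum>m\<le>n. \<Sum>k<d.
      (\<Sum>a\<le>m. \<Sum>h<d. P a $$ (i, h) * (R (m - a) $$ (h, k)) ^ (?q ^ a)) * (S (n
          - m) $$ (k, j)) ^ (?q ^ m))"
    using assms ij by (simp add: tw_mult_index)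
  also have "\<dots> = (\<Sum>m\<le>n. \<Sum>a\<le>m. g a (m - a))"
  proof (rule sum.cong[OF refl])
    fix m assume "m \<in> {..n}"
    have "(\<Sum>k<d. (\<Sum>a\<le>m. \<Sum>h<d. P a $$ (i, h) * (R (m - a) $$ (h, k)) ^ (?q ^ a)) * (S (n
        - m) $$ (k, j)) ^ (?q ^ m))
       = (\<Sum>k<d. \<Sum>a\<le>m. \<Sum>h<d. P a $$ (i, h) * (R (m - a) $$ (h, k)) ^ (?q ^ a) * (S (n
           - m) $$ (k, j)) ^ (?q ^ m))"
      by (simp add: sum_distrib_right)
    also have "\<dots> = (\<Sum>a\<le>m. \<Sum>k<d. \<Sum>h<d. P a $$ (i, h) * (R (m - a) $$ (h, k)) ^ (?q ^ a) * (S (n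
        - m) $$ (k, j)) ^ (?q ^ m))"
      by (rule sum.swap)
    also have "\<dots> = (\<Sum>a\<le>m. \<Sum>h<d. \<Sum>k<d. P a $$ (i, h) * (R (m - a) $$ (h, k)) ^ (?q ^ a) * (S (n
        - m) $$ (k, j)) ^ (?q ^ m))"
      by (rule sum.cong[OF refl], rule sum.swap)
    also have "\<dots> = (\<Sum>a\<le>m. g a (m - a))"
      by (rule sum.cong) (auto simp: g_def)
    finally show "(\<Sum>k<d. (\<Sum>a\<le>m. \<Sum>h<d. P a $$ (i, h) * (R (m - a) $$ (h, k)) ^ (?q ^ a)) * (S (n
        - m) $$ (k, j)) ^ (?q ^ m))
       = (\<Sum>a\<le>m. g a (m - a))" .
  qed
  also have "\<dots> = (\<Sum>a\<le>n. \<Sum>b\<le>n - a. g a b)" by (rule sum_triangle_split)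
  also have "\<dots> = (\<Sum>a\<le>n. \<Sum>h<d. P a $$ (i, h) *
      (\<Sum>b\<le>n - a. \<Sum>k<d. R b $$ (h, k) * (S (n - a - b) $$ (k, j)) ^ (?q ^ b)) ^ (?q ^ a))"
  proof (rule sum.cong[OF refl])
    fix a assume "a \<in> {..n}"
    have "(\<Sum>b\<le>n - a. g a b) = (\<Sum>h<d. \<Sum>b\<le>n - a. \<Sum>k<d. P a $$ (i, h) * (R b $$ (h, k)) ^ (?q ^ a) *
      (S (n - (a + b)) $$ (k, j)) ^ (?q ^ (a + b)))"
      unfolding g_def by (rule sum.swap)
    also have "\<dots> = (\<Sum>h<d. P a $$ (i, h) *
      (\<Sum>b\<le>n - a. \<Sum>k<d. R b $$ (h, k) * (S (n - a - b) $$ (k, j)) ^ (?q ^ b)) ^ (?q ^ a))"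
      by (simp add: frob_sum sum_distrib_left power_mult_distrib mult.assoc power_add
          mult.commute[of "?q ^ a"]
          flip: power_mult)
    finally show "(\<Sum>b\<le>n - a. g a b) = (\<Sum>h<d. P a $$ (i, h) *
      (\<Sum>b\<le>n - a. \<Sum>k<d. R b $$ (h, k) * (S (n - a - b) $$ (k, j)) ^ (?q ^ b)) ^ (?q ^ a))" .
  qed
  also have "\<dots> = tw_mult ?q d P (tw_mult ?q d R S) n $$ (i, j)"
    using assms ij by (simp add: tw_mult_index)
  finally show "tw_mult ?q d (tw_mult ?q d P R) S n $$ (i, j)
      = tw_mult ?q d P (tw_mult ?q d R S) n $$ (i, j)" .
qed auto

end

section \<open>A Sylvester equation with nilpotent coefficient\<close>

text \<open>The equation c X = N X - X N - B is a fixed point problem. With N strictly upper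
  triangular, an entry depends only on entries further down or further left, so iteration from 0
  becomes stationary.\<close>

lemma sylvester_nilpotent_exists:
  fixes N B :: "nat \<Rightarrow> nat \<Rightarrow> 'a::field"
  assumes "c \<noteq> 0" and N: "\<And>i j. N i j \<noteq> 0 \<Longrightarrow> i < j"
  obtains X where "\<And>i j. i < d \<Longrightarrow> j < d \<Longrightarrow>
    c * X i j = (\<Sum>k<d. N i k * X k j) - (\<Sum>k<d. X i k * N k j) - B i j"
proof -
  define F where "F X i j = ((\<Sum>k<d. N i k * X k j) - (\<Sum>k<d. X i k * N k j) - B i j) / c" for X i j
  define X where "X n = (F ^^ n) (\<lambda>_ _. 0)" for n
  have X_Suc: "X (Suc n) = F (X n)" for n by (simp add: X_def)
  \<comment> \<open>A nonzero \<open>N i k\<close> forces k > i and a nonzero \<open>N k j\<close>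
    forces k < j, so \<open>d - i + j\<close> drops with every reference; it is positive, which
    settles n = 0.\<close>
  have stab: "X (Suc n) i j = X n i j" if "i < d" "j < d" "d - i + j \<le> n" for n i j
    using that
  proof (induction n arbitrary: i j)
    case (Suc n)
    have "N i k * X (Suc n) k j = N i k * X n k j" if "k < d" for k
      using N[of i k] Suc.prems that by (cases "N i k = 0") (auto intro!: Suc.IH)
    moreover have "X (Suc n) i k * N k j = X n i k * N k j" if "k < d" for k
      using N[of k j] Suc.prems that by (cases "N k j = 0") (auto intro!: Suc.IH)
    ultimately show ?case by (simp add: X_Suc[of "Suc n"] X_Suc[of n] F_def)
  qed simp
  show ?thesis
  proof
    fix i j assume "i < d" "j < d"
    \<comment> \<open>For i, j < d the measure \<open>d - i + j\<close> stays below 2d, so 2d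
      iterations suffice for all entries at once.\<close>
    then have "F (X (2 * d)) i j = X (2 * d) i j" using stab[of i j "2 * d"] by (simp add: X_Suc)
    then show "c * X (2 * d) i j
        = (\<Sum>k<d. N i k * X (2 * d) k j) - (\<Sum>k<d. X (2 * d) i k * N k j) - B i j"
      using \<open>c \<noteq> 0\<close> by (simp add: F_def field_simps)
  qed
qed

text \<open>Induction on \<open>d - i + j\<close>: all entries of X and Y with nonzero coefficient
  on the right have smaller measure, and c can be cancelled.\<close>

lemma sylvester_nilpotent_unique:
  fixes N B :: "nat \<Rightarrow> nat \<Rightarrow> 'a::field"
  assumes "c \<noteq> 0" and N: "\<And>i j. N i j \<noteq> 0 \<Longrightarrow> i < j"
    and X: "\<And>i j. i < d \<Longrightarrow> j < d \<Longrightarrow>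
      c * X i j = (\<Sum>k<d. N i k * X k j) - (\<Sum>k<d. X i k * N k j) - B i j"
    and Y: "\<And>i j. i < d \<Longrightarrow> j < d \<Longrightarrow>
      c * Y i j = (\<Sum>k<d. N i k * Y k j) - (\<Sum>k<d. Y i k * N k j) - B i j"
    and "i < d" "j < d"
  shows "X i j = Y i j"
  using assms(5,6)
proof (induction "d - i + j" arbitrary: i j rule: less_induct)
  case less
  have "N i k * X k j = N i k * Y k j" if "k < d" for k
    using N[of i k] less.prems that by (cases "N i k = 0") (auto intro!: less.hyps)
  then have "(\<Sum>k<d. N i k * X k j) = (\<Sum>k<d. N i k * Y k j)" by (intro sum.cong) auto
  moreover have "X i k * N k j = Y i k * N k j" if "k < d" for k
    using N[of k j] less.prems that by (cases "N k j = 0") (auto intro!: less.hyps)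
  then have "(\<Sum>k<d. X i k * N k j) = (\<Sum>k<d. Y i k * N k j)" by (intro sum.cong) auto
  ultimately have "c * X i j = c * Y i j"
    using X[OF less.prems] Y[OF less.prems] by simp
  then show ?case using \<open>c \<noteq> 0\<close> by simp
qed

section \<open>Block positions\<close>

lemma tot_dim_eq: "tot_dim s = blk_start s (length s)"
  by (simp add: tot_dim_def blk_start_def)

lemma blk_start_Suc: "blk_start s (Suc l) = blk_start s l + blk_dim s l"
  by (simp add: blk_start_def)

lemma blk_start_mono: "l \<le> m \<Longrightarrow> blk_start s l \<le> blk_start s m"
  unfolding blk_start_def by (rule sum_mono2) auto

lemma blk_start_add_less_tot:
  assumes "l < length s" "j < blk_dim s l"
  shows "blk_start s l + j < tot_dim s"
proof -
  have "blk_start s l + j < blk_start s (Suc l)" using assms by (simp add: blk_start_Suc)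
  also have "\<dots> \<le> tot_dim s" unfolding tot_dim_eq by (rule blk_start_mono) (use assms in auto)
  finally show ?thesis .
qed

lemma sum_blocks:
  fixes f :: "nat \<Rightarrow> 'a::comm_monoid_add"
  shows "(\<Sum>p<blk_start s n. f p) = (\<Sum>l<n. \<Sum>j<blk_dim s l. f (blk_start s l + j))"
proof (induction n)
  case 0
  then show ?case by (simp add: blk_start_def)
next
  case (Suc n)
  have "(\<Sum>p<blk_start s (Suc n). f p)
      = (\<Sum>p<blk_start s n. f p) + (\<Sum>p\<in>{blk_start s n..<blk_start s n + blk_dim s n}. f p)"
    using sum.atLeastLessThan_concat[of 0 "blk_start s n" "blk_start s n + blk_dim s n" f]
    by (simp add: blk_start_Suc atLeast0LessThan)
  also have "(\<Sum>p\<in>{blk_start s n..<blk_start s n + blk_dim s n}. f p)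
      = (\<Sum>j<blk_dim s n. f (blk_start s n + j))"
    using sum.shift_bounds_nat_ivl[of f 0 "blk_start s n" "blk_dim s n"]
    by (simp add: atLeast0LessThan add.commute)
  finally show ?case using Suc by simp
qed

lemma sum_tot_dim:
  fixes f :: "nat \<Rightarrow> 'a::comm_monoid_add"
  shows "(\<Sum>p<tot_dim s. f p) = (\<Sum>l<length s. \<Sum>j<blk_dim s l. f (blk_start s l + j))"
  by (simp add: tot_dim_eq sum_blocks)

text \<open>With \<open>block_position_exists\<close> this identifies the positions below
  \<open>tot_dim s\<close> with pairs of a block and an offset inside it.\<close>

lemma block_position_unique:
  assumes "j < blk_dim s l" "k < blk_dim s m" "blk_start s l + j = blk_start s m + k"
  shows "l = m \<and> j = k"
proof -
  have "\<not> l < m" if "j < blk_dim s l" "blk_start s l + j = blk_start s m + k" for l m j k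
  proof
    assume "l < m"
    then have "blk_start s (Suc l) \<le> blk_start s m" by (intro blk_start_mono) auto
    with that show False by (simp add: blk_start_Suc)
  qed
  from this[of j l m k] this[of k m l j] assms have "l = m" by force
  with assms show ?thesis by simp
qed

lemma block_position_exists:
  assumes "p < tot_dim s"
  obtains l j where "l < length s" "j < blk_dim s l" "p = blk_start s l + j"
proof -
  have "\<exists>l<n. \<exists>j<blk_dim s l. p = blk_start s l + j" if "p < blk_start s n" for n
    using that
  proof (induction n)
    case (Suc n)
    show ?case
    proof (cases "p < blk_start s n")
      case True
      with Suc show ?thesis by (meson less_SucI)
    next
      case False
      with Suc.prems show ?thesis
        by (intro exI[of _ n] conjI exI[of _ "p - blk_start s n"]) (auto simp: blk_start_Suc)
    qed
  qed (simp add: blk_start_def)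
  with assms that show ?thesis unfolding tot_dim_eq by blast
qed

text \<open>The superdiagonal of ones is interrupted exactly where a block ends, that is, where
  \<open>Suc i\<close> is a partial sum of the lengths. The induction strips the first block and
  shifts both indices by its length.\<close>

lemma diag_block_shift_index:
  fixes ds :: "nat list"
  defines "J \<equiv> \<lambda>d. mat d d (\<lambda>(i, j). if j = Suc i then 1 else 0) :: 'a::field mat"
  assumes "i < sum_list ds" "j < sum_list ds"
  shows "diag_block_mat (map J ds) $$ (i, j)
    = (if j = Suc i \<and> (\<forall>l<length ds. Suc i \<noteq> sum_list (take (Suc l) ds)) then 1 else 0)"
  using assms(2,3)
proof (induction ds arbitrary: i j)
  case (Cons d ds)
  have dim: "dim_row (diag_block_mat (map J ds)) = sum_list ds"
    "dim_col (diag_block_mat (map J ds)) = sum_list ds"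
    by (simp_all add: dim_diag_block_mat J_def o_def)
  have all: "(\<forall>l<length (d # ds). Suc i \<noteq> sum_list (take (Suc l) (d # ds))) \<longleftrightarrow>
      Suc i \<noteq> d \<and> (\<forall>l<length ds. Suc i \<noteq> d + sum_list (take (Suc l) ds))"
    by (simp add: All_less_Suc2)
  have J: "dim_row (J d) = d" "dim_col (J d) = d"
    "i < d \<Longrightarrow> j < d \<Longrightarrow> J d $$ (i, j) = (if j = Suc i then 1 else 0)" for i j
    by (auto simp: J_def)
  have "diag_block_mat (map J (d # ds)) $$ (i, j) =
    (if i < d then if j < d then J d $$ (i, j) else 0
     else if j < d then 0 else diag_block_mat (map J ds) $$ (i - d, j - d))"
    using Cons.prems dim J by (auto simp: Let_def)
  also have "\<dots> = (if j = Suc i \<and> (\<forall>l<length (d # ds). Suc i \<noteq> sum_list (take (Suc l) (d # ds)))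
      then 1 else 0)"
  proof (cases "i < d \<or> j < d")
    case True
    then show ?thesis unfolding all using J(3) by auto
  next
    case False
    have "(Suc i = d + x) = (Suc (i - d) = x)" for x using False by auto
    moreover have "(j - d = Suc (i - d)) = (j = Suc i)" using False by auto
    moreover have "diag_block_mat (map J ds) $$ (i - d, j - d)
      = (if j - d = Suc (i - d) \<and> (\<forall>l<length ds. Suc (i - d) \<noteq> sum_list (take (Suc l) ds)) then 1
          else 0)"
      by (rule Cons.IH) (use Cons.prems False in auto)
    ultimately show ?thesis unfolding all using False by simp
  qed
  finally show ?case .
qed simp

lemma N_mat_carrier [simp]: "N_mat s \<in> carrier_mat (tot_dim s) (tot_dim s)"
  by (auto simp: N_mat_def dim_diag_block_mat tot_dim_def o_def interv_sum_list_conv_sum_set_nat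
      atLeast0LessThan)

lemma N_mat_index:
  assumes "i < tot_dim s" "j < tot_dim s"
  shows "(N_mat s :: 'a::field mat) $$ (i, j) =
    (if j = Suc i \<and> (\<forall>l<length s. Suc i \<noteq> blk_start s (Suc l)) then 1 else 0)"
proof -
  let ?ds = "map (blk_dim s) [0..<length s]"
  have sum: "sum_list (take n ?ds) = blk_start s n" if "n \<le> length s" for n
    using that by (simp add: take_map take_upt interv_sum_list_conv_sum_set_nat blk_start_def
        atLeast0LessThan)
  have tot: "sum_list ?ds = tot_dim s"
    by (simp add: interv_sum_list_conv_sum_set_nat tot_dim_def atLeast0LessThan)
  have "(N_mat s :: 'a mat) = diag_block_mat (map (\<lambda>d. mat d d (\<lambda>(i, j). if j = Suc i then 1
      else 0)) ?ds)"
    by (simp add: N_mat_def o_def)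
  then have "(N_mat s :: 'a mat) $$ (i, j) =
      (if j = Suc i \<and> (\<forall>l<length ?ds. Suc i \<noteq> sum_list (take (Suc l) ?ds)) then 1 else 0)"
    using diag_block_shift_index[of i ?ds j] assms unfolding tot by simp
  moreover have "(\<forall>l<length ?ds. Suc i \<noteq> sum_list (take (Suc l) ?ds))
      \<longleftrightarrow> (\<forall>l<length s. Suc i \<noteq> blk_start s (Suc l))"
    using sum[of "Suc _"] by (auto simp: Suc_le_eq)
  ultimately show ?thesis by simp
qed

section \<open>The logarithm of the \<open>t\<close>-module\<close>

lemma E_mat_carrier [simp]: "E_mat s u \<in> carrier_mat (tot_dim s) (tot_dim s)"
  by (simp add: E_mat_def)

context v_adic_complex_field
begin

lemma fq_embed_0: "fq_embed \<iota> 0 = 0" and fq_embed_1: "fq_embed \<iota> 1 = 1"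
  by (simp_all add: fq_embed_def flip: Zero_fract_def One_fract_def one_pCons)

lemma rho_t_carrier [simp]: "rho_t \<iota> s u n \<in> carrier_mat (tot_dim s) (tot_dim s)"
  by (simp add: rho_t_def)

lemma rho_carrier [simp]: "rho \<iota> s u a n \<in> carrier_mat (tot_dim s) (tot_dim s)"
  by (simp add: rho_def)

lemma rho_t_0_index:
  "i < tot_dim s \<Longrightarrow> j < tot_dim s \<Longrightarrow>
    rho_t \<iota> s u 0 $$ (i, j) = (if i = j then theta \<iota> else 0) + N_mat s $$ (i, j)"
  by (auto simp: rho_t_def carrier_matD[OF N_mat_carrier])

lemma N_mat_index_power:
  "i < tot_dim s \<Longrightarrow> j < tot_dim s \<Longrightarrow> (N_mat s $$ (i, j) :: 'c) ^ (CARD('f) ^ n) = N_mat s $$ (i, j)"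
  by (simp add: N_mat_index power_0_left)

lemma sum_rho_t_0_left:
  assumes "i < tot_dim s"
  shows "(\<Sum>k<tot_dim s. rho_t \<iota> s u 0 $$ (i, k) * f k)
    = theta \<iota> * f i + (\<Sum>k<tot_dim s. N_mat s $$ (i, k) * f k)"
proof -
  have "(\<Sum>k<tot_dim s. rho_t \<iota> s u 0 $$ (i, k) * f k)
      = (\<Sum>k<tot_dim s. (if k = i then theta \<iota> * f k else 0) + N_mat s $$ (i, k) * f k)"
    by (rule sum.cong) (use assms in \<open>auto simp: rho_t_0_index algebra_simps\<close>)
  then show ?thesis using assms by (simp add: sum.distrib)
qed

lemma sum_rho_t_0_right:
  assumes "j < tot_dim s"
  shows "(\<Sum>k<tot_dim s. f k * (rho_t \<iota> s u 0 $$ (k, j)) ^ (CARD('f) ^ n))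
    = theta \<iota> ^ (CARD('f) ^ n) * f j + (\<Sum>k<tot_dim s. f k * N_mat s $$ (k, j))"
proof -
  have "(\<Sum>k<tot_dim s. f k * (rho_t \<iota> s u 0 $$ (k, j)) ^ (CARD('f) ^ n))
      = (\<Sum>k<tot_dim s. (if k = j then theta \<iota> ^ (CARD('f) ^ n) * f k
          else 0) + f k * N_mat s $$ (k, j))"
    by (rule sum.cong)
      (use assms in \<open>auto simp: rho_t_0_index frob_add N_mat_index_power power_0_left
          algebra_simps\<close>)
  then show ?thesis using assms by (simp add: sum.distrib)
qed

lemma tw_mult_rho_t_0_index:
  assumes "\<And>n. P n \<in> carrier_mat (tot_dim s) (tot_dim s)" "i < tot_dim s" "j < tot_dim s"
  shows "tw_mult CARD('f) (tot_dim s) P (rho_t \<iota> s u) 0 $$ (i, j)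
    = theta \<iota> * P 0 $$ (i, j) + (\<Sum>k<tot_dim s. P 0 $$ (i, k) * N_mat s $$ (k, j))"
  using sum_rho_t_0_right[of j s "\<lambda>k. P 0 $$ (i, k)" u 0] assms by (simp add: tw_mult_index)

text \<open>\<open>rho_t\<close> has degree one in \<tau>, so only \<open>P (Suc n)\<close> against
  \<theta> + N and \<open>P n\<close> against E contribute.\<close>

lemma tw_mult_rho_t_Suc_index:
  assumes "\<And>n. P n \<in> carrier_mat (tot_dim s) (tot_dim s)" "i < tot_dim s" "j < tot_dim s"
  shows "tw_mult CARD('f) (tot_dim s) P (rho_t \<iota> s u) (Suc n) $$ (i, j)
    = theta \<iota> ^ (CARD('f) ^ Suc n) * P (Suc n) $$ (i, j)
      + (\<Sum>k<tot_dim s. P (Suc n) $$ (i, k) * N_mat s $$ (k, j))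
      + (\<Sum>k<tot_dim s. P n $$ (i, k) * (E_mat s u $$ (k, j)) ^ (CARD('f) ^ n))"
proof -
  let ?q = "CARD('f)" and ?d = "tot_dim s"
  let ?g = "\<lambda>m. \<Sum>k<?d. P m $$ (i, k) * (rho_t \<iota> s u (Suc n - m) $$ (k, j)) ^ (?q ^ m)"
  have "?g m = 0" if "m < n" for m
    using that assms(2,3) by (auto simp: rho_t_def power_0_left)
  then have "(\<Sum>m\<le>n. ?g m) = ?g n"
    by (subst sum.mono_neutral_right[of _ "{n}"]) auto
  moreover have "?g n = (\<Sum>k<?d. P n $$ (i, k) * (E_mat s u $$ (k, j)) ^ (?q ^ n))"
    by (simp add: rho_t_def)
  moreover have "tw_mult ?q ?d P (rho_t \<iota> s u) (Suc n) $$ (i, j) = (\<Sum>m\<le>n. ?g m) + ?g (Suc n)"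
    using assms by (simp add: tw_mult_index)
  moreover have "?g (Suc n) = theta \<iota> ^ (?q ^ Suc n) * P (Suc n) $$ (i, j)
      + (\<Sum>k<?d. P (Suc n) $$ (i, k) * N_mat s $$ (k, j))"
    using sum_rho_t_0_right[of j s "\<lambda>k. P (Suc n) $$ (i, k)" u "Suc n"] assms by simp
  ultimately show ?thesis by simp
qed

text \<open>This is the \<tau>^(n+1) coefficient of log \<circ> \<rho>\<open>\<^sub>t\<close> =
  \<partial>\<rho>\<open>\<^sub>t\<close> \<circ> log, solved for [n+1] P(n+1): a Sylvester equation
  with nilpotent coefficient N.\<close>

definition log_rec :: "nat list \<Rightarrow> 'c list \<Rightarrow> 'c twisted \<Rightarrow> bool" where
  "log_rec s u P \<longleftrightarrow> (\<forall>n i j. i < tot_dim s \<longrightarrow> j < tot_dim s \<longrightarrow>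
    bracket (Suc n) * P (Suc n) $$ (i, j)
      = (\<Sum>k<tot_dim s. N_mat s $$ (i, k) * P (Suc n) $$ (k, j))
      - (\<Sum>k<tot_dim s. P (Suc n) $$ (i, k) * N_mat s $$ (k, j))
      - (\<Sum>k<tot_dim s. P n $$ (i, k) * (E_mat s u $$ (k, j)) ^ (CARD('f) ^ n)))"

text \<open>The constant coefficients agree because \<open>P 0\<close> is the identity; the
  agreement of all others is the recursion.\<close>

lemma tw_mult_rho_t_commute_iff:
  assumes P: "\<And>n. P n \<in> carrier_mat (tot_dim s) (tot_dim s)" "P 0 = 1\<^sub>m (tot_dim s)"
  shows "tw_mult CARD('f) (tot_dim s) P (rho_t \<iota> s u)
      = tw_mult CARD('f) (tot_dim s) (tw_const (tot_dim s) (rho_t \<iota> s u 0)) P \<longleftrightarrow> log_rec s u P"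
    (is "?L = ?R \<longleftrightarrow> _")
proof -
  let ?q = "CARD('f)" and ?d = "tot_dim s"
  have R: "?R n $$ (i, j) = theta \<iota> * P n $$ (i, j) + (\<Sum>k<?d. N_mat s $$ (i, k) * P n $$ (k, j))"
    if "i < ?d" "j < ?d" for n i j
    using that P(1) by (simp add: tw_mult_const_index sum_rho_t_0_left)
  have zero: "?L 0 $$ (i, j) = ?R 0 $$ (i, j)" if "i < ?d" "j < ?d" for i j
  proof -
    have "(\<Sum>k<?d. (1\<^sub>m ?d) $$ (i, k) * N_mat s $$ (k, j)) = (\<Sum>k<?d. if k = i
        then N_mat s $$ (k, j) else (0::'c))"
      by (rule sum.cong) (use that in auto)
    moreover have "(\<Sum>k<?d. N_mat s $$ (i, k) * (1\<^sub>m ?d) $$ (k, j)) = (\<Sum>k<?d. if k = j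
        then N_mat s $$ (i, k) else (0::'c))"
      by (rule sum.cong) (use that in auto)
    ultimately show ?thesis using that P by (simp add: tw_mult_rho_t_0_index R)
  qed
  have suc: "?L (Suc n) $$ (i, j) = ?R (Suc n) $$ (i, j) \<longleftrightarrow>
     bracket (Suc n) * P (Suc n) $$ (i, j)
      = (\<Sum>k<?d. N_mat s $$ (i, k) * P (Suc n) $$ (k, j))
      - (\<Sum>k<?d. P (Suc n) $$ (i, k) * N_mat s $$ (k, j))
      - (\<Sum>k<?d. P n $$ (i, k) * (E_mat s u $$ (k, j)) ^ (?q ^ n))" if "i < ?d" "j < ?d" for n i j
    using that P(1) unfolding R[OF that] bracket_def
    by (subst tw_mult_rho_t_Suc_index) (auto simp: algebra_simps)
  show ?thesis
  proof
    assume "?L = ?R"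
    then show "log_rec s u P" unfolding log_rec_def using suc by auto
  next
    assume *: "log_rec s u P"
    show "?L = ?R"
    proof (rule twisted_eqI[of _ ?d])
      fix n i j assume "i < ?d" "j < ?d"
      with * zero suc show "?L n $$ (i, j) = ?R n $$ (i, j)"
        unfolding log_rec_def by (cases n) auto
    qed auto
  qed
qed

text \<open>By associativity P is moved past one factor R at a time, each time replacing that factor
  by its constant term.\<close>

lemma tw_power_commute:
  assumes P: "\<And>n. P n \<in> carrier_mat d d" and R: "\<And>n. R n \<in> carrier_mat d d"
    and comm: "tw_mult CARD('f) d P R = tw_mult CARD('f) d (tw_const d (R 0)) P"
  shows "tw_mult CARD('f) d P (tw_power CARD('f) d R k)
    = tw_mult CARD('f) d (tw_const d (tw_power CARD('f) d R k 0)) (P :: 'c twisted)"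
proof (induction k)
  case 0
  then show ?case using P by (simp add: tw_power_0 tw_mult_one_left tw_mult_one_right) (simp add:
      tw_const_def tw_mult_one_left[unfolded tw_const_def])
next
  case (Suc k)
  let ?q = "CARD('f)" and ?R = "tw_power CARD('f) d R k"
  \<comment> \<open>Taking the \<tau>^0 coefficient is multiplicative.\<close>
  have const: "tw_mult ?q d (tw_const d (R 0)) (tw_const d (?R 0))
      = tw_const d (tw_mult ?q d R ?R 0)"
  proof (rule twisted_eqI[of _ d])
    fix n i j assume "i < d" "j < d"
    then show "tw_mult ?q d (tw_const d (R 0)) (tw_const d (?R 0)) n $$ (i, j)
        = tw_const d (tw_mult ?q d R ?R 0) n $$ (i, j)"
      using R by (simp add: tw_mult_const_index) (auto simp: tw_const_def tw_mult_index)
  qed (use R in auto)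
  have "tw_mult ?q d P (tw_power ?q d R (Suc k)) = tw_mult ?q d (tw_mult ?q d P R) ?R"
    using P R by (simp add: tw_power_Suc tw_mult_assoc)
  also have "\<dots> = tw_mult ?q d (tw_const d (R 0)) (tw_mult ?q d P ?R)"
    using P R by (simp add: comm tw_mult_assoc)
  also have "\<dots> = tw_mult ?q d (tw_mult ?q d (tw_const d (R 0)) (tw_const d (?R 0))) P"
    using P R by (simp add: Suc tw_mult_assoc)
  finally show ?case by (simp add: const tw_power_Suc)
qed

text \<open>The coefficients of a are fixed by Frobenius, so they pass through P, and the relation
  for \<rho>\<open>\<^sub>t\<close> extends from its powers to every
  \<rho>\<open>\<^sub>a\<close>.\<close>

lemma rho_commute:
  assumes P: "\<And>n. P n \<in> carrier_mat (tot_dim s) (tot_dim s)"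
    and comm: "tw_mult CARD('f) (tot_dim s) P (rho_t \<iota> s u)
      = tw_mult CARD('f) (tot_dim s) (tw_const (tot_dim s) (rho_t \<iota> s u 0)) P"
  shows "tw_mult CARD('f) (tot_dim s) P (rho \<iota> s u a)
      = tw_mult CARD('f) (tot_dim s) (tw_const (tot_dim s) (rho \<iota> s u a 0)) P"
proof (rule twisted_eqI[of _ "tot_dim s"])
  let ?q = "CARD('f)" and ?d = "tot_dim s"
  let ?R = "tw_power ?q ?d (rho_t \<iota> s u)" and ?c = "\<lambda>k. fq_embed \<iota> (coeff a k)"
  fix n i j assume ij: "i < ?d" "j < ?d"
  have rho: "rho \<iota> s u a n $$ (i, j)
      = (\<Sum>k\<le>degree a. ?c k * ?R k n $$ (i, j))" if "i < ?d" "j < ?d" for n i j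
    using that by (simp add: rho_def)
  have "tw_mult ?q ?d P (rho \<iota> s u a) n $$ (i, j)
      = (\<Sum>m\<le>n. \<Sum>h<?d. P m $$ (i, h) * (\<Sum>k\<le>degree a. ?c k * ?R k (n - m) $$ (h, j)) ^ (?q ^ m))"
    using P ij by (simp add: tw_mult_index rho)
  also have "\<dots> = (\<Sum>m\<le>n. \<Sum>h<?d. \<Sum>k\<le>degree a. ?c k * (P m $$ (i, h) * (?R k (n
      - m) $$ (h, j)) ^ (?q ^ m)))"
    by (simp add: frob_sum power_mult_distrib frob_fq sum_distrib_left mult_ac)
  also have "\<dots> = (\<Sum>m\<le>n. \<Sum>k\<le>degree a. \<Sum>h<?d. ?c k * (P m $$ (i, h) * (?R k (n
      - m) $$ (h, j)) ^ (?q ^ m)))"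
    by (rule sum.cong[OF refl], rule sum.swap)
  also have "\<dots> = (\<Sum>k\<le>degree a. \<Sum>m\<le>n. \<Sum>h<?d. ?c k * (P m $$ (i, h) * (?R k (n
      - m) $$ (h, j)) ^ (?q ^ m)))"
    by (rule sum.swap)
  also have "\<dots> = (\<Sum>k\<le>degree a. ?c k * tw_mult ?q ?d P (?R k) n $$ (i, j))"
    using P ij by (simp add: tw_mult_index sum_distrib_left)
  also have "\<dots> = (\<Sum>k\<le>degree a. ?c k * tw_mult ?q ?d (tw_const ?d (?R k 0)) P n $$ (i, j))"
    using tw_power_commute[OF P _ comm] by simp
  also have "\<dots> = (\<Sum>k\<le>degree a. \<Sum>h<?d. ?c k * ?R k 0 $$ (i, h) * P n $$ (h, j))"
    using P ij by (simp add: tw_mult_const_index sum_distrib_left mult.assoc)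
  also have "\<dots> = (\<Sum>h<?d. \<Sum>k\<le>degree a. ?c k * ?R k 0 $$ (i, h) * P n $$ (h, j))"
    by (rule sum.swap)
  also have "\<dots> = tw_mult ?q ?d (tw_const ?d (rho \<iota> s u a 0)) P n $$ (i, j)"
    using P ij by (simp add: tw_mult_const_index rho sum_distrib_right)
  finally show "tw_mult ?q ?d P (rho \<iota> s u a) n $$ (i, j)
      = tw_mult ?q ?d (tw_const ?d (rho \<iota> s u a 0)) P n $$ (i, j)" .
qed auto

lemma rho_X: "rho \<iota> s u [:0, 1:] = rho_t \<iota> s u"
proof (rule twisted_eqI[of _ "tot_dim s"])
  fix n i j assume "i < tot_dim s" "j < tot_dim s"
  moreover have "tw_power CARD('f) (tot_dim s) (rho_t \<iota> s u) 1 = rho_t \<iota> s u"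
    by (simp add: tw_power_Suc tw_power_0 tw_mult_one_right)
  ultimately show "rho \<iota> s u [:0, 1:] n $$ (i, j) = rho_t \<iota> s u n $$ (i, j)"
    by (simp add: rho_def fq_embed_0 fq_embed_1)
qed auto

text \<open>One Sylvester equation is solved in each degree; its scalar [n+1] is nonzero.\<close>

lemma log_rec_exists:
  obtains P where "\<And>n. P n \<in> carrier_mat (tot_dim s) (tot_dim s)" "P 0
      = 1\<^sub>m (tot_dim s)" "log_rec s u P"
proof -
  let ?q = "CARD('f)" and ?d = "tot_dim s"
  define step where "step n X Y \<longleftrightarrow> (\<forall>i j. i < ?d \<longrightarrow> j < ?d \<longrightarrow> bracket (Suc n) * Y $$ (i, j)
      = (\<Sum>k<?d. N_mat s $$ (i, k) * Y $$ (k, j)) - (\<Sum>k<?d. Y $$ (i, k) * N_mat s $$ (k, j))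
      - (\<Sum>k<?d. X $$ (i, k) * (E_mat s u $$ (k, j)) ^ (?q ^ n)))" for n X Y
  have "\<exists>Y. Y \<in> carrier_mat ?d ?d \<and> step n X Y" for n X
  proof -
    \<comment> \<open>Extension by zero makes strict triangularity hold for all indices, not only
      those inside the matrix.\<close>
    define N' :: "nat \<Rightarrow> nat \<Rightarrow> 'c"
      where "N' i j = (if i < ?d \<and> j < ?d then N_mat s $$ (i, j) else 0)" for i j
    have "N' i j \<noteq> 0 \<Longrightarrow> i < j" for i j by (auto simp: N'_def N_mat_index split: if_splits)
    then obtain Z where Z: "\<And>i j. i < ?d \<Longrightarrow> j < ?d \<Longrightarrow> bracket (Suc n) * Z i j
        = (\<Sum>k<?d. N' i k * Z k j) - (\<Sum>k<?d. Z i k * N' k j)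
        - (\<Sum>k<?d. X $$ (i, k) * (E_mat s u $$ (k, j)) ^ (?q ^ n))"
      using sylvester_nilpotent_exists[of "bracket (Suc n)" N' ?d
          "\<lambda>i j. \<Sum>k<?d. X $$ (i, k) * (E_mat s u $$ (k, j)) ^ (?q ^ n)"] bracket_nonzero by blast
    show ?thesis
      by (rule exI[of _ "mat ?d ?d (\<lambda>(i, j). Z i j)"]) (auto simp: step_def Z N'_def)
  qed
  then obtain nxt where nxt: "\<And>n X. nxt n X \<in> carrier_mat ?d ?d" "\<And>n X. step n X (nxt n X)"
    by metis
  define P where "P = rec_nat (1\<^sub>m ?d) nxt"
  show ?thesis
  proof
    show "P n \<in> carrier_mat ?d ?d" for n by (cases n) (auto simp: P_def nxt)
    show "P 0 = 1\<^sub>m ?d" by (simp add: P_def)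
    have "step n (P n) (P (Suc n))" for n using nxt(2) by (simp add: P_def)
    then show "log_rec s u P" by (simp add: log_rec_def step_def)
  qed
qed

lemma log_rec_unique:
  assumes "\<And>n. P n \<in> carrier_mat (tot_dim s) (tot_dim s)" "P 0 = 1\<^sub>m (tot_dim s)" "log_rec s u P"
    and "\<And>n. R n \<in> carrier_mat (tot_dim s) (tot_dim s)" "R 0 = 1\<^sub>m (tot_dim s)" "log_rec s u R"
  shows "P = R"
proof
  fix n
  let ?q = "CARD('f)" and ?d = "tot_dim s"
  show "P n = R n"
  proof (induction n)
    case (Suc n)
    define N' :: "nat \<Rightarrow> nat \<Rightarrow> 'c"
      where "N' i j = (if i < ?d \<and> j < ?d then N_mat s $$ (i, j) else 0)" for i j
    have N': "N' i j \<noteq> 0 \<Longrightarrow> i < j" for i j by (auto simp: N'_def N_mat_index split: if_splits)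
    let ?B = "\<lambda>i j. \<Sum>k<?d. P n $$ (i, k) * (E_mat s u $$ (k, j)) ^ (?q ^ n)"
    show ?case
    proof (rule eq_matI)
      fix i j assume "i < dim_row (R (Suc n))" "j < dim_col (R (Suc n))"
      then have ij: "i < ?d" "j < ?d" using assms(4)[of "Suc n"] by auto
      have 1: "bracket (Suc n) * P (Suc n) $$ (i, j) = (\<Sum>k<?d. N' i k * P (Suc n) $$ (k, j))
          - (\<Sum>k<?d. P (Suc n) $$ (i, k) * N' k j) - ?B i j" if "i < ?d" "j < ?d" for i j
        using assms(3) that by (simp add: log_rec_def N'_def)
      have 2: "bracket (Suc n) * R (Suc n) $$ (i, j) = (\<Sum>k<?d. N' i k * R (Suc n) $$ (k, j))
          - (\<Sum>k<?d. R (Suc n) $$ (i, k) * N' k j) - ?B i j" if "i < ?d" "j < ?d" for i j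
        using assms(6) that by (simp add: log_rec_def N'_def Suc)
      show "P (Suc n) $$ (i, j) = R (Suc n) $$ (i, j)"
        by (rule sylvester_nilpotent_unique[where c = "bracket (Suc n)" and N = N' and d
            = ?d and B = ?B
              and X = "\<lambda>i j. P (Suc n) $$ (i, j)" and Y = "\<lambda>i j. R (Suc n) $$ (i, j)"])
          (use bracket_nonzero N' 1 2 ij in auto)
    qed (use assms(1,4)[of "Suc n"] in auto)
  qed (simp add: assms)
qed

text \<open>Existence and uniqueness give the \<open>THE\<close> in \<open>log_coeffs\<close> its
  meaning. The condition for all a reduces to the recursion by taking a = t, and follows from it by
  \<open>rho_commute\<close>.\<close>

lemma
  shows log_coeffs_carrier: "log_coeffs \<iota> s u n \<in> carrier_mat (tot_dim s) (tot_dim s)"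
    and log_coeffs_0: "log_coeffs \<iota> s u 0 = 1\<^sub>m (tot_dim s)"
    and log_coeffs_rec: "log_rec s u (log_coeffs \<iota> s u)"
proof -
  let ?C = "\<lambda>P. (\<forall>n. P n \<in> carrier_mat (tot_dim s) (tot_dim s)) \<and> P 0 = 1\<^sub>m (tot_dim s) \<and>
     (\<forall>a::'f poly. tw_mult CARD('f) (tot_dim s) P (rho \<iota> s u a) =
        tw_mult CARD('f) (tot_dim s) (tw_const (tot_dim s) (rho \<iota> s u a 0)) P)"
  have rec: "log_rec s u P" if "?C P" for P
  proof -
    from that have "tw_mult CARD('f) (tot_dim s) P (rho \<iota> s u [:0, 1:]) =
        tw_mult CARD('f) (tot_dim s) (tw_const (tot_dim s) (rho \<iota> s u [:0, 1:] 0)) P" by blast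
    with that show ?thesis unfolding rho_X by (subst tw_mult_rho_t_commute_iff[symmetric]) auto
  qed
  obtain P where P: "\<And>n. P n \<in> carrier_mat (tot_dim s) (tot_dim s)" "P 0
      = 1\<^sub>m (tot_dim s)" "log_rec s u P"
    by (rule log_rec_exists[of s u]) blast
  have "?C P"
    using P rho_commute[of P s u] tw_mult_rho_t_commute_iff[of P s u] by blast
  moreover have "R = P" if "?C R" for R
    by (rule log_rec_unique[of _ s u]) (use that P rec in auto)
  ultimately have "\<exists>!P. ?C P" by (intro ex1I[of ?C P])
  then have "?C (log_coeffs \<iota> s u)" unfolding log_coeffs_def by (rule theI')
  with rec show "log_coeffs \<iota> s u n \<in> carrier_mat (tot_dim s) (tot_dim s)"
    "log_coeffs \<iota> s u 0 = 1\<^sub>m (tot_dim s)" "log_rec s u (log_coeffs \<iota> s u)" by blast+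
qed

end

section \<open>The last row of the first block of the logarithm\<close>

text \<open>The corner entry of the block E[lm]. Taking the arguments as a function allows sequences
  that agree on an initial segment to be compared.\<close>

definition E_coeff :: "(nat \<Rightarrow> 'a::field) \<Rightarrow> nat \<Rightarrow> nat \<Rightarrow> 'a" where
  "E_coeff w l m = (- 1) ^ (m - l) * (\<Prod>e\<in>{l..<m}. w e)"

context v_adic_complex_field
begin

text \<open>With \<open>D\<close> the block lengths and \<open>w\<close> the arguments, \<open>lcoeff D w n l\<close> is the entry of the
  \<open>n\<close>-th logarithm coefficient in the last row of the first block and the last column of block \<open>l\<close>.\<close>

primrec lcoeff :: "(nat \<Rightarrow> nat) \<Rightarrow> (nat \<Rightarrow> 'c) \<Rightarrow> nat \<Rightarrow> nat \<Rightarrow> 'c" where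
  "lcoeff D w 0 = (\<lambda>l. if l = 0 then 1 else 0)"
| "lcoeff D w (Suc n) = (\<lambda>l. (- 1 / bracket (Suc n)) ^ D l *
     (\<Sum>k\<le>l. lcoeff D w n k * E_coeff w k l ^ (CARD('f) ^ n)))"

text \<open>The recursion at l refers only to indices k \<le> l. This locality lets an index and its
  merged versions share their series.\<close>

lemma lcoeff_cong:
  assumes "\<And>k. k \<le> l \<Longrightarrow> D k = D' k" "\<And>k. k < l \<Longrightarrow> w k = w' k"
  shows "lcoeff D w n l = lcoeff D' w' n l"
  using assms
proof (induction n arbitrary: l)
  case (Suc n)
  have "lcoeff D w n k * E_coeff w k l ^ (CARD('f) ^ n)
      = lcoeff D' w' n k * E_coeff w' k l ^ (CARD('f) ^ n)"
    if "k \<le> l" for k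
  proof -
    have "lcoeff D w n k = lcoeff D' w' n k" using Suc.prems that by (intro Suc.IH) auto
    moreover have "E_coeff w k l = E_coeff w' k l"
      unfolding E_coeff_def using Suc.prems by (intro arg_cong2[where f="(*)"] refl prod.cong) auto
    ultimately show ?thesis by simp
  qed
  then have "(\<Sum>k\<le>l. lcoeff D w n k * E_coeff w k l ^ (CARD('f) ^ n))
      = (\<Sum>k\<le>l. lcoeff D' w' n k * E_coeff w' k l ^ (CARD('f) ^ n))"
    by (intro sum.cong) auto
  with Suc.prems show ?case by simp
qed simp

lemma absv_E_coeff_le:
  assumes "\<And>e. e < m \<Longrightarrow> absv (w e :: 'c) \<le> 1"
  shows "absv (E_coeff w l m) \<le> 1"
proof -
  have "(\<Prod>e\<in>{l..<m}. absv (w e)) \<le> 1"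
    by (rule prod_le_1) (use assms in auto)
  then show ?thesis by (simp add: E_coeff_def absv_mult absv_power absv_prod)
qed

text \<open>Each step multiplies by at most M inverse brackets, each of absolute value at most
  q^(deg v), while the entries of E are integral.\<close>

lemma absv_lcoeff_le:
  assumes D: "\<And>l. l < r \<Longrightarrow> D l \<le> M" and w: "\<And>e. e < r \<Longrightarrow> absv (w e) \<le> 1" and "l < r"
  shows "absv (lcoeff D w n l) \<le> ((real CARD('f) ^ degree v) ^ M) ^ n"
  using \<open>l < r\<close>
proof (induction n arbitrary: l)
  case (Suc n)
  let ?C = "real CARD('f) ^ degree v"
  have C1: "?C \<ge> 1" using card_field_ge_2[where 'f='f] by simp
  have "inverse (absv (bracket (Suc n))) \<le> inverse (inverse ?C)"
    by (rule le_imp_inverse_le[OF absv_bracket_ge]) simp_all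
  then have "absv (- 1 / bracket (Suc n)) \<le> ?C"
    by (simp add: divide_inverse absv_mult absv_inverse)
  then have "absv ((- 1 / bracket (Suc n)) ^ D l) \<le> ?C ^ D l"
    unfolding absv_power by (rule power_mono) simp
  also have "\<dots> \<le> ?C ^ M" using C1 D[OF Suc.prems] by (intro power_increasing)
  finally have 1: "absv ((- 1 / bracket (Suc n)) ^ D l) \<le> ?C ^ M" .
  have 2: "absv (\<Sum>k\<le>l. lcoeff D w n k * E_coeff w k l ^ (CARD('f) ^ n)) \<le> (?C ^ M) ^ n"
  proof (rule absv_sum_le)
    fix k assume "k \<in> {..l}"
    then have "absv (lcoeff D w n k) \<le> (?C ^ M) ^ n" using Suc by auto
    moreover have "absv (E_coeff w k l ^ (CARD('f) ^ n)) \<le> 1"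
      unfolding absv_power
      by (rule power_le_one) (use w Suc.prems absv_E_coeff_le[of l w k] in auto)
    ultimately have "absv (lcoeff D w n k) * absv (E_coeff w k l ^ (CARD('f) ^ n))
        \<le> (?C ^ M) ^ n * 1"
      using C1 by (intro mult_mono) auto
    then show "absv (lcoeff D w n k * E_coeff w k l ^ (CARD('f) ^ n)) \<le> (?C ^ M) ^ n"
      by (simp add: absv_mult)
  qed (use C1 in auto)
  show ?case
    using mult_mono[OF 1 2] C1 by (simp add: absv_mult)
qed simp

lemma lcoeff_tendsto_0:
  assumes "\<And>l. l < r \<Longrightarrow> D l \<le> M" "\<And>e. e < r \<Longrightarrow> absv (w e) \<le> 1" "l < r" "absv (x::'c) < 1"
  shows "(\<lambda>n. absv (lcoeff D w n l) * absv x ^ (CARD('f) ^ n)) \<longlonglongrightarrow> 0"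
proof (rule tendsto_sandwich[OF _ _ tendsto_const])
  show "\<forall>\<^sub>F n in sequentially. absv (lcoeff D w n l) * absv x ^ (CARD('f) ^ n)
      \<le> ((real CARD('f) ^ degree v) ^ M) ^ n * absv x ^ (CARD('f) ^ n)"
    using absv_lcoeff_le[of r D M w] assms
    by (intro always_eventually allI mult_right_mono zero_le_power absv_nonneg) auto
  show "(\<lambda>n. ((real CARD('f) ^ degree v) ^ M) ^ n * absv x ^ (CARD('f) ^ n)) \<longlonglongrightarrow> 0"
    using assms card_field_ge_2 by (intro power_times_double_exp_power_tendsto_0) auto
qed simp

definition lseries :: "(nat \<Rightarrow> nat) \<Rightarrow> (nat \<Rightarrow> 'c) \<Rightarrow> nat \<Rightarrow> 'c \<Rightarrow> 'c" where
  "lseries D w l x = (\<Sum>n. lcoeff D w n l * x ^ (CARD('f) ^ n))"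

lemma lseries_sums:
  assumes "\<And>l. l < r \<Longrightarrow> D l \<le> M" "\<And>e. e < r \<Longrightarrow> absv (w e) \<le> 1" "l < r" "absv x < 1"
  shows "(\<lambda>n. lcoeff D w n l * x ^ (CARD('f) ^ n)) sums lseries D w l x"
  unfolding lseries_def
  by (intro summable_sums summable_c)
    (use lcoeff_tendsto_0[of r D M w l x] assms in \<open>simp add: absv_mult absv_power\<close>)

end

locale t_module = v_adic_complex_field v \<iota>
  for v :: "'f::{field,finite} poly" and \<iota> :: "'f poly fract \<Rightarrow> 'c::{field,complete_space}" +
  fixes \<sigma> :: "nat list" and \<omega> :: "'c list"
  assumes \<sigma>_nonempty: "\<sigma> \<noteq> []"
    and \<sigma>_pos: "\<And>i. i < length \<sigma> \<Longrightarrow> \<sigma> ! i \<ge> 1"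
    and length_\<omega>: "length \<omega> = length \<sigma>"
    and \<omega>_le: "\<And>i. i < length \<sigma> \<Longrightarrow> absv (\<omega> ! i) \<le> 1"
begin

section \<open>Blocks and the distinguished row of a fixed module\<close>

abbreviation "r \<equiv> length \<sigma>"
abbreviation "d \<equiv> tot_dim \<sigma>"
abbreviation "bd l \<equiv> blk_dim \<sigma> l"
abbreviation "start l \<equiv> blk_start \<sigma> l"
abbreviation "e l m \<equiv> E_coeff ((!) \<omega>) l m"
abbreviation "y n l \<equiv> lcoeff (blk_dim \<sigma>) ((!) \<omega>) n l"

lemma dim_pos:
  assumes "l < r"
  shows "bd l > 0"
proof -
  have "drop l \<sigma> = \<sigma> ! l # drop (Suc l) \<sigma>" using assms by (simp add: Cons_nth_drop_Suc)
  then show ?thesis using \<sigma>_pos[OF assms] by (simp add: blk_dim_def)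
qed

lemma dim_le: "bd l \<le> bd 0"
  unfolding blk_dim_def by (metis append_take_drop_id drop0 le_add2 sum_list_append)

lemma r_pos: "r > 0" using \<sigma>_nonempty by simp

lemma blk_last_eq: "l < r \<Longrightarrow> blk_last \<sigma> l = start l + (bd l - 1)"
  using dim_pos[of l] by (simp add: blk_last_def)

lemma start_0 [simp]: "start 0 = 0" by (simp add: blk_start_def)

lemma blk_last_less: "l < r \<Longrightarrow> blk_last \<sigma> l < d"
  unfolding blk_last_eq by (rule blk_start_add_less_tot) (use dim_pos[of l] in auto)

lemma row_less: "bd 0 - 1 < d"
  using blk_last_less[of 0] r_pos by (simp add: blk_last_eq)

text \<open>Position \<open>bd 0 - 1\<close> is the last row of the first block, where the shift has
  no 1. Hence the term N P disappears from the recursion for this row.\<close>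

lemma N_row: "p < d \<Longrightarrow> N_mat \<sigma> $$ (bd 0 - 1, p) = (0::'c)"
  using row_less r_pos dim_pos[of 0] by (auto simp: N_mat_index blk_start_Suc)

lemma sum_N_column:
  fixes f :: "nat \<Rightarrow> 'c"
  assumes "l < r" "j < bd l"
  shows "(\<Sum>k<d. f k * N_mat \<sigma> $$ (k, start l + j)) = (if j = 0 then 0 else f (start l + j - 1))"
proof (cases j)
  case 0
  have "N_mat \<sigma> $$ (k, start l) = (0::'c)" if "k < d" for k
  proof (cases l)
    case (Suc l')
    then show ?thesis
      using that assms \<open>j = 0\<close> blk_start_add_less_tot[OF assms] Suc_lessD[of l' r]
      by (auto simp: N_mat_index intro!: exI[of _ l'])
  qed (use that assms \<open>j = 0\<close> blk_start_add_less_tot[OF assms] in \<open>simp add: N_mat_index\<close>)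
  then show ?thesis using 0 by simp
next
  case (Suc i)
  have less: "start l + j < d" using assms by (rule blk_start_add_less_tot)
  \<comment> \<open>A position with positive offset never starts a block, so the superdiagonal 1 in
    this column is present.\<close>
  have "start l + j \<noteq> start (Suc l')" for l'
  proof (cases "l' < l")
    case True
    then have "start (Suc l') \<le> start l" by (intro blk_start_mono) auto
    with Suc show ?thesis by simp
  next
    case False
    then have "start (Suc l) \<le> start (Suc l')" by (intro blk_start_mono) auto
    with assms show ?thesis by (simp add: blk_start_Suc)
  qed
  then have "(\<Sum>k<d. f k * N_mat \<sigma> $$ (k, start l + j)) = (\<Sum>k<d. if k = start l + i then f k else 0)"
    using less Suc by (intro sum.cong) (auto simp: N_mat_index)
  then show ?thesis using less Suc by simp
qed

lemma E_mat_index: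
  assumes "k < d" "m < r" "j < bd m"
  shows "E_mat \<sigma> \<omega> $$ (k, start m + j) = (\<Sum>l\<le>m. if k = blk_last \<sigma> l \<and> j = 0 then e l m else 0)"
proof -
  have eq: "start m + j = start m' \<longleftrightarrow> m = m' \<and> j = 0" if "m' < r" for m'
    using block_position_unique[of j \<sigma> m 0 m'] assms dim_pos[OF that] by auto
  have "E_mat \<sigma> \<omega> $$ (k, start m + j) = (\<Sum>l<r. \<Sum>m'\<in>{l..<r}.
       if k = blk_last \<sigma> l \<and> start m + j = start m' then e l m' else 0)"
    using assms blk_start_add_less_tot[OF assms(2,3)] unfolding E_coeff_def by (simp add: E_mat_def)
  also have "\<dots> = (\<Sum>l<r. \<Sum>m'\<in>{l..<r}.
       if m' = m then (if k = blk_last \<sigma> l \<and> j = 0 then e l m' else 0) else 0)"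
    by (intro sum.cong refl) (auto simp: eq)
  also have "\<dots> = (\<Sum>l<r. if l \<le> m then (if k = blk_last \<sigma> l \<and> j = 0 then e l m else 0) else 0)"
    using assms by (intro sum.cong refl) (simp add: sum.delta)
  also have "\<dots> = (\<Sum>l\<in>{l. l < r \<and> l \<le> m}. if k = blk_last \<sigma> l \<and> j = 0 then e l m else 0)"
    by (simp add: sum.If_cases Int_def)
  also have "{l. l < r \<and> l \<le> m} = {..m}" using assms by auto
  finally show ?thesis .
qed

lemma sum_E_column:
  assumes "m < r" "j < bd m"
  shows "(\<Sum>k<d. f k * (E_mat \<sigma> \<omega> $$ (k, start m + j)) ^ (CARD('f) ^ n))
    = (if j = 0 then (\<Sum>l\<le>m. f (blk_last \<sigma> l) * e l m ^ (CARD('f) ^ n)) else 0)"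
proof -
  have "(\<Sum>k<d. f k * (E_mat \<sigma> \<omega> $$ (k, start m + j)) ^ (CARD('f) ^ n))
      = (\<Sum>k<d. \<Sum>l\<le>m. if k = blk_last \<sigma> l then (if j = 0 then f k * e l m ^ (CARD('f) ^ n) else 0)
          else 0)"
    using assms
    by (intro sum.cong refl) (auto simp: E_mat_index frob_sum sum_distrib_left power_0_left
        intro!: sum.cong)
  also have "\<dots> = (\<Sum>l\<le>m. \<Sum>k<d. if k = blk_last \<sigma> l then (if j = 0 then f k * e l m ^ (CARD('f) ^ n)
      else 0) else 0)"
    by (rule sum.swap)
  also have "\<dots> = (\<Sum>l\<le>m. if j = 0 then f (blk_last \<sigma> l) * e l m ^ (CARD('f) ^ n) else 0)"
    using assms blk_last_less by (intro sum.cong refl) auto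
  finally show ?thesis by simp
qed

definition row_coeff :: "nat \<Rightarrow> nat \<Rightarrow> 'c" where
  "row_coeff n p = log_coeffs \<iota> \<sigma> \<omega> n $$ (bd 0 - 1, p)"

lemma row_coeff_0: "p < d \<Longrightarrow> row_coeff 0 p = (if p = bd 0 - 1 then 1 else 0)"
  using row_less by (simp add: row_coeff_def log_coeffs_0)

lemma row_coeff_rec:
  assumes "p < d"
  shows "bracket (Suc n) * row_coeff (Suc n) p = - (\<Sum>k<d. row_coeff (Suc n) k * N_mat \<sigma> $$ (k, p))
    - (\<Sum>k<d. row_coeff n k * (E_mat \<sigma> \<omega> $$ (k, p)) ^ (CARD('f) ^ n))"
  using log_coeffs_rec[of \<sigma> \<omega>] assms row_less N_row unfolding log_rec_def row_coeff_def by simp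

text \<open>Along a block the recursion puts -c/[n+1] into the first column, c being the
  contribution of E, and multiplies by -1/[n+1] from each column to the next. The result is then
  expressed through the last entry.\<close>

lemma row_coeff_eq:
  assumes "m < r" "j < bd m"
  shows "row_coeff n (start m + j) = y n m * (- bracket n) ^ (bd m - 1 - j)"
  using assms
proof (induction n arbitrary: m j)
  case 0
  have less: "start m + j < d" using 0 by (rule blk_start_add_less_tot)
  have "start m + j = bd 0 - 1 \<longleftrightarrow> m = 0 \<and> j = bd 0 - 1"
    using block_position_unique[of j \<sigma> m "bd 0 - 1" 0] 0 dim_pos[of 0] r_pos by auto
  \<comment> \<open>Since [0] = 0 and \<open>0 ^ 0\<close> is 1, the power is nonzero only at the
    last offset, as the identity matrix demands.\<close>
  then show ?case using 0 less by (auto simp: row_coeff_0 power_0_left)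
next
  case (Suc n)
  let ?b = "bracket (Suc n)"
  define c where "c = (\<Sum>k\<le>m. y n k * e k m ^ (CARD('f) ^ n))"
  have b: "?b \<noteq> 0" by (rule bracket_nonzero) simp
  have y: "y (Suc n) m = (- 1 / ?b) ^ bd m * c" by (simp add: c_def)
  have last: "row_coeff n (blk_last \<sigma> l) = y n l" if "l < r" for l
    using Suc.IH[OF that, of "bd l - 1"] dim_pos[OF that] that by (simp add: blk_last_eq)
  have E0: "(\<Sum>k<d. row_coeff n k * (E_mat \<sigma> \<omega> $$ (k, start m + j)) ^ (CARD('f) ^ n)) = (if j = 0
      then c else 0)"
    if "j < bd m" for j
    using sum_E_column[of m j "row_coeff n" n] Suc.prems that last
        by (auto simp: c_def intro!: sum.cong)
  have rec: "?b * row_coeff (Suc n) (start m + j)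
      = - (if j = 0 then 0 else row_coeff (Suc n) (start m + j - 1)) - (if j = 0 then c else 0)"
    if "j < bd m" for j
    using row_coeff_rec[of "start m + j" n] sum_N_column[of m j "row_coeff (Suc n)"] E0[OF that]
      blk_start_add_less_tot[of m \<sigma> j] Suc.prems(1) that by simp
  \<comment> \<open>Inner induction along the block, starting at its first column.\<close>
  have "row_coeff (Suc n) (start m + j) = (- 1 / ?b) ^ Suc j * c" using Suc.prems(2)
  proof (induction j)
    case 0
    then show ?case using rec[of 0] b by (simp add: field_simps)
  next
    case (Suc j)
    then have "row_coeff (Suc n) (start m + Suc j) = (- 1 / ?b) * row_coeff (Suc n) (start m + j)"
      using rec[of "Suc j"] b by (simp add: field_simps)
    then show ?case using Suc by simp
  qed
  \<comment> \<open>Changes the reference point from the first column of the block to its last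
    one.\<close>
  moreover have "(- 1 / ?b) ^ bd m * (- ?b) ^ (bd m - 1 - j) = (- 1 / ?b) ^ Suc j"
  proof -
    have "(- 1 / ?b) ^ bd m = (- 1 / ?b) ^ Suc j * (- 1 / ?b) ^ (bd m - 1 - j)"
      using Suc.prems(2) by (simp only: power_add[symmetric]) simp
    moreover have "(- 1 / ?b) ^ (bd m - 1 - j) * (- ?b) ^ (bd m - 1 - j) = 1"
      using b by (simp flip: power_mult_distrib)
    ultimately show ?thesis by (simp add: mult.assoc)
  qed
  ultimately show ?case unfolding y by (simp add: mult_ac)
qed

end

lemma mult_mat_vec_index_sum:
  assumes "M \<in> carrier_mat d d" "x \<in> carrier_vec d" "i < d"
  shows "(M *\<^sub>v map_vec f x) $ i = (\<Sum>k<d. M $$ (i, k) * f (x $ k))"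
  using assms by (auto simp: scalar_prod_def lessThan_atLeast0 intro!: sum.cong)

section \<open>The operators \<rho>\<open>\<^sub>a\<close> on points\<close>

context v_adic_complex_field
begin

lemma tendsto_sum_c:
  assumes "\<And>i. i \<in> I \<Longrightarrow> ((f i :: nat \<Rightarrow> 'c) \<longlongrightarrow> a i) F"
  shows "((\<lambda>n. \<Sum>i\<in>I. f i n) \<longlongrightarrow> (\<Sum>i\<in>I. a i)) F"
  using assms
  by (induction I rule: infinite_finite_induct) (auto intro!: tendsto_add_c)

lemma frob_sum1: "(sum f I :: 'c) ^ CARD('f) = (\<Sum>i\<in>I. f i ^ CARD('f))"
  using frob_sum[of f I 1] by simp

lemma frob_fq1: "fq_embed \<iota> c ^ CARD('f) = fq_embed \<iota> c"
  using frob_fq[of c 1] by simp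

lemma tw_mult_rho_t_left_index:
  assumes R: "\<And>n. R n \<in> carrier_mat (tot_dim s) (tot_dim s)" and "i < tot_dim s" "j < tot_dim s"
  shows "tw_mult CARD('f) (tot_dim s) (rho_t \<iota> s u) R n $$ (i, j)
    = (\<Sum>h<tot_dim s. rho_t \<iota> s u 0 $$ (i, h) * R n $$ (h, j))
    + (if n = 0 then 0 else \<Sum>h<tot_dim s. E_mat s u $$ (i, h) * (R (n - 1) $$ (h, j)) ^ CARD('f))"
proof -
  let ?g = "\<lambda>m. \<Sum>h<tot_dim s. rho_t \<iota> s u m $$ (i, h) * (R (n - m) $$ (h, j)) ^ (CARD('f) ^ m)"
  have zero: "?g m = 0" if "m \<ge> 2" for m
    using that assms by (auto simp: rho_t_def)
  have "tw_mult CARD('f) (tot_dim s) (rho_t \<iota> s u) R n $$ (i, j) = (\<Sum>m\<le>n. ?g m)"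
    using assms by (simp add: tw_mult_index)
  also have "\<dots> = (\<Sum>m\<in>{m. m \<le> n \<and> m < 2}. ?g m)"
    by (rule sum.mono_neutral_right) (use zero in \<open>auto simp: not_less\<close>)
  also have "{m. m \<le> n \<and> m < 2} = (if n = 0 then {0} else {0, 1})" by auto
  also have "(\<Sum>m\<in>\<dots>. ?g m) = ?g 0 + (if n = 0 then 0 else ?g 1)" by simp
  also have "?g 1 = (\<Sum>h<tot_dim s. E_mat s u $$ (i, h) * (R (n - 1) $$ (h, j)) ^ CARD('f))"
    by (simp add: rho_t_def)
  finally show ?thesis by simp
qed

text \<open>The action of \<open>\<rho>\<^sub>t\<close> on points, which are represented by their coordinate functions.\<close>

definition rho_t_act :: "nat list \<Rightarrow> 'c list \<Rightarrow> (nat \<Rightarrow> 'c) \<Rightarrow> nat \<Rightarrow> 'c" where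
  "rho_t_act s u x p = (\<Sum>k<tot_dim s. rho_t \<iota> s u 0 $$ (p, k) * x k)
    + (\<Sum>k<tot_dim s. E_mat s u $$ (p, k) * x k ^ CARD('f))"

text \<open>Each factor \<rho>\<open>\<^sub>t\<close> raises the degree in \<tau> by at most one;
  evaluating \<rho>\<open>\<^sub>a\<close> is therefore a finite sum.\<close>

lemma tw_power_rho_t_eq_0:
  assumes "n > j" "p < tot_dim s" "k < tot_dim s"
  shows "tw_power CARD('f) (tot_dim s) (rho_t \<iota> s u) j n $$ (p, k) = 0"
  using assms
proof (induction j arbitrary: n p k)
  case 0
  then show ?case by (simp add: tw_power_0 tw_const_def)
next
  case (Suc j)
  then show ?case
    by (simp add: tw_power_Suc tw_mult_rho_t_left_index power_0_left)
qed

text \<open>Evaluation turns twisted multiplication into composition. The free bound M lets the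
  degree of a serve later for all powers j simultaneously.\<close>

lemma tw_power_rho_t_eval:
  assumes "p < tot_dim s" "j \<le> M"
  shows "(\<Sum>n\<le>M. \<Sum>k<tot_dim s. tw_power CARD('f) (tot_dim s) (rho_t \<iota> s u) j n $$ (p, k)
      * x k ^ (CARD('f) ^ n))
    = (rho_t_act s u ^^ j) x p"
  using assms
proof (induction j arbitrary: p M)
  case 0
  let ?d = "tot_dim s"
  have "(\<Sum>n\<le>M. \<Sum>k<?d. tw_power CARD('f) ?d (rho_t \<iota> s u) 0 n $$ (p, k) * x k ^ (CARD('f) ^ n))
      = (\<Sum>n\<in>{0}. \<Sum>k<?d. tw_power CARD('f) ?d (rho_t \<iota> s u) 0 n $$ (p, k) * x k ^ (CARD('f) ^ n))"
    by (rule sum.mono_neutral_right) (use 0 in \<open>auto simp: tw_power_0 tw_const_def\<close>)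
  also have "\<dots> = (\<Sum>k<?d. (1\<^sub>m ?d) $$ (p, k) * x k)"
    by (simp add: tw_power_0 tw_const_def)
  also have "\<dots> = (\<Sum>k<?d. if k = p then x k else 0)"
    by (rule sum.cong) (use 0 in auto)
  finally show ?case using 0 by simp
next
  case (Suc j)
  let ?d = "tot_dim s" and ?q = "CARD('f)"
  let ?R = "tw_power ?q ?d (rho_t \<iota> s u) j"
  obtain M' where M: "M = Suc M'" "j \<le> M'" using Suc.prems by (cases M) auto
  have 1: "(\<Sum>n\<le>M. \<Sum>k<?d. (\<Sum>h<?d. rho_t \<iota> s u 0 $$ (p, h) * ?R n $$ (h, k)) * x k ^ (?q ^ n))
      = (\<Sum>h<?d. rho_t \<iota> s u 0 $$ (p, h) * (rho_t_act s u ^^ j) x h)"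
  proof -
    have "(\<Sum>n\<le>M. \<Sum>k<?d. (\<Sum>h<?d. rho_t \<iota> s u 0 $$ (p, h) * ?R n $$ (h, k)) * x k ^ (?q ^ n))
       = (\<Sum>n\<le>M. \<Sum>k<?d. \<Sum>h<?d. rho_t \<iota> s u 0 $$ (p, h) * (?R n $$ (h, k) * x k ^ (?q ^ n)))"
      by (simp add: sum_distrib_right mult.assoc)
    also have "\<dots> = (\<Sum>n\<le>M. \<Sum>h<?d. \<Sum>k<?d. rho_t \<iota> s u 0 $$ (p, h) * (?R n $$ (h, k)
        * x k ^ (?q ^ n)))"
      by (rule sum.cong[OF refl], rule sum.swap)
    also have "\<dots> = (\<Sum>h<?d. \<Sum>n\<le>M. \<Sum>k<?d. rho_t \<iota> s u 0 $$ (p, h) * (?R n $$ (h, k)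
        * x k ^ (?q ^ n)))"
      by (rule sum.swap)
    also have "\<dots> = (\<Sum>h<?d. rho_t \<iota> s u 0 $$ (p, h) * (\<Sum>n\<le>M. \<Sum>k<?d. ?R n $$ (h, k)
        * x k ^ (?q ^ n)))"
      by (simp add: sum_distrib_left)
    also have "\<dots> = (\<Sum>h<?d. rho_t \<iota> s u 0 $$ (p, h) * (rho_t_act s u ^^ j) x h)"
      using Suc.IH[of _ M] Suc.prems by simp
    finally show ?thesis .
  qed
  have 2: "(\<Sum>n\<le>M. \<Sum>k<?d. (if n = 0 then 0
      else \<Sum>h<?d. E_mat s u $$ (p, h) * (?R (n - 1) $$ (h, k)) ^ ?q) * x k ^ (?q ^ n))
      = (\<Sum>h<?d. E_mat s u $$ (p, h) * (rho_t_act s u ^^ j) x h ^ ?q)"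
  proof -
    \<comment> \<open>After shifting n by one, every summand is a q-th power, and additivity of
      Frobenius moves this power outside the evaluated sum.\<close>
    have "(\<Sum>n\<le>M. \<Sum>k<?d. (if n = 0 then 0
        else \<Sum>h<?d. E_mat s u $$ (p, h) * (?R (n - 1) $$ (h, k)) ^ ?q) * x k ^ (?q ^ n))
       = (\<Sum>n\<le>M'. \<Sum>k<?d. (\<Sum>h<?d. E_mat s u $$ (p, h) * (?R n $$ (h, k)) ^ ?q) * x k ^ (?q ^ Suc n))"
      unfolding M(1) by (subst sum.atMost_Suc_shift) simp
    also have "\<dots> = (\<Sum>n\<le>M'. \<Sum>k<?d. \<Sum>h<?d. E_mat s u $$ (p, h) * (?R n $$ (h, k)
        * x k ^ (?q ^ n)) ^ ?q)"
      by (simp add: sum_distrib_right mult.assoc power_mult_distrib flip: power_mult)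
        (simp add: mult.commute)
    also have "\<dots> = (\<Sum>n\<le>M'. \<Sum>h<?d. \<Sum>k<?d. E_mat s u $$ (p, h) * (?R n $$ (h, k)
        * x k ^ (?q ^ n)) ^ ?q)"
      by (rule sum.cong[OF refl], rule sum.swap)
    also have "\<dots> = (\<Sum>h<?d. \<Sum>n\<le>M'. \<Sum>k<?d. E_mat s u $$ (p, h) * (?R n $$ (h, k)
        * x k ^ (?q ^ n)) ^ ?q)"
      by (rule sum.swap)
    also have "\<dots> = (\<Sum>h<?d. E_mat s u $$ (p, h) * (\<Sum>n\<le>M'. \<Sum>k<?d. ?R n $$ (h, k)
        * x k ^ (?q ^ n)) ^ ?q)"
      by (simp add: frob_sum1 sum_distrib_left)
    also have "\<dots> = (\<Sum>h<?d. E_mat s u $$ (p, h) * (rho_t_act s u ^^ j) x h ^ ?q)"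
      using Suc.IH[of _ M'] M by simp
    finally show ?thesis .
  qed
  have "(\<Sum>n\<le>M. \<Sum>k<?d. tw_power ?q ?d (rho_t \<iota> s u) (Suc j) n $$ (p, k) * x k ^ (?q ^ n))
     = (\<Sum>n\<le>M. \<Sum>k<?d. (\<Sum>h<?d. rho_t \<iota> s u 0 $$ (p, h) * ?R n $$ (h, k)) * x k ^ (?q ^ n)) +
       (\<Sum>n\<le>M. \<Sum>k<?d. (if n = 0 then 0
           else \<Sum>h<?d. E_mat s u $$ (p, h) * (?R (n - 1) $$ (h, k)) ^ ?q) * x k ^ (?q ^ n))"
    unfolding sum.distrib[symmetric] distrib_right[symmetric] tw_power_Suc
    by (intro sum.cong refl arg_cong2[where f = "(*)"] tw_mult_rho_t_left_index)
      (use Suc.prems in auto)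
  also have "\<dots> = (rho_t_act s u ^^ Suc j) x p" unfolding 1 2 by (simp add: rho_t_act_def)
  finally show ?case .
qed

definition rho_act :: "nat list \<Rightarrow> 'c list \<Rightarrow> 'f poly \<Rightarrow> (nat \<Rightarrow> 'c) \<Rightarrow> nat \<Rightarrow> 'c" where
  "rho_act s u a x p = (\<Sum>k\<le>degree a. fq_embed \<iota> (coeff a k) * (rho_t_act s u ^^ k) x p)"

text \<open>Replaces the series defining \<open>rho_point\<close> by iterates of one operator on
  coordinate functions, where linearity and commutation are easy to use.\<close>

lemma rho_point_index:
  assumes "p < tot_dim s"
  shows "rho_point \<iota> s u a $ p = rho_act s u a (\<lambda>p. special_point s u $ p) p"
proof -
  let ?d = "tot_dim s" and ?q = "CARD('f)"
  let ?R = "tw_power ?q ?d (rho_t \<iota> s u)" and ?x = "\<lambda>p. special_point s u $ p"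
  have sp: "special_point s u \<in> carrier_vec ?d" by (simp add: special_point_def)
  have rho: "rho \<iota> s u a n $$ (p, k) = (\<Sum>j\<le>degree a. fq_embed \<iota> (coeff a j) * ?R j n $$ (p, k))"
    if "k < ?d" for n k
    using that assms by (simp add: rho_def)
  have "rho_point \<iota> s u a $ p = (\<Sum>n. \<Sum>k<?d. rho \<iota> s u a n $$ (p, k) * ?x k ^ (?q ^ n))"
    unfolding rho_point_def tw_eval_def using assms sp
    by (simp add: mult_mat_vec_index_sum[OF rho_carrier sp] del: index_mult_mat_vec)
  also have "\<dots> = (\<Sum>n\<le>degree a. \<Sum>k<?d. rho \<iota> s u a n $$ (p, k) * ?x k ^ (?q ^ n))"
    by (rule suminf_finite) (auto simp: rho tw_power_rho_t_eq_0 assms)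
  also have "\<dots> = (\<Sum>n\<le>degree a. \<Sum>k<?d. \<Sum>j\<le>degree a. fq_embed \<iota> (coeff a j) * (?R j n $$ (p, k)
      * ?x k ^ (?q ^ n)))"
    by (simp add: rho sum_distrib_right mult.assoc)
  also have "\<dots> = (\<Sum>n\<le>degree a. \<Sum>j\<le>degree a. \<Sum>k<?d. fq_embed \<iota> (coeff a j) * (?R j n $$ (p, k)
      * ?x k ^ (?q ^ n)))"
    by (rule sum.cong[OF refl], rule sum.swap)
  also have "\<dots> = (\<Sum>j\<le>degree a. \<Sum>n\<le>degree a. \<Sum>k<?d. fq_embed \<iota> (coeff a j) * (?R j n $$ (p, k)
      * ?x k ^ (?q ^ n)))"
    by (rule sum.swap)
  also have "\<dots> = (\<Sum>j\<le>degree a. fq_embed \<iota> (coeff a j) * (\<Sum>n\<le>degree a. \<Sum>k<?d. ?R j n $$ (p, k)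
      * ?x k ^ (?q ^ n)))"
    by (simp add: sum_distrib_left)
  also have "\<dots> = rho_act s u a ?x p"
    unfolding rho_act_def by (intro sum.cong refl arg_cong2[where f
        = "(*)"] tw_power_rho_t_eval) (use assms in auto)
  finally show ?thesis .
qed

lemma rho_t_act_cong: "(\<And>k. k < tot_dim s \<Longrightarrow> x k = x' k) \<Longrightarrow> rho_t_act s u x = rho_t_act s u x'"
  by (rule ext) (simp add: rho_t_act_def)

text \<open>Constants from the finite field are unchanged by the q-th power in the E part, so the
  action is linear over that field.\<close>

lemma rho_t_act_power_linear:
  "(rho_t_act s u ^^ j) (\<lambda>p. \<Sum>k\<in>K. fq_embed \<iota> (c k) * z k p)
    = (\<lambda>p. \<Sum>k\<in>K. fq_embed \<iota> (c k) * (rho_t_act s u ^^ j) (z k) p)"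
proof (induction j)
  case (Suc j)
  have "rho_t_act s u (\<lambda>p. \<Sum>k\<in>K. fq_embed \<iota> (c k) * z k p) p
      = (\<Sum>k\<in>K. fq_embed \<iota> (c k) * rho_t_act s u (z k) p)" for z :: "'a \<Rightarrow> nat \<Rightarrow> 'c" and p
  proof -
    have "(\<Sum>h<tot_dim s. rho_t \<iota> s u 0 $$ (p, h) * (\<Sum>k\<in>K. fq_embed \<iota> (c k) * z k h))
        = (\<Sum>k\<in>K. fq_embed \<iota> (c k) * (\<Sum>h<tot_dim s. rho_t \<iota> s u 0 $$ (p, h) * z k h))"
      unfolding sum_distrib_left by (subst sum.swap) (simp add: mult_ac)
    moreover have "(\<Sum>h<tot_dim s. E_mat s u $$ (p, h) * (\<Sum>k\<in>K. fq_embed \<iota> (c k) * z k h) ^ CARD('f))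
        = (\<Sum>k\<in>K. fq_embed \<iota> (c k) * (\<Sum>h<tot_dim s. E_mat s u $$ (p, h) * z k h ^ CARD('f)))"
      unfolding sum_distrib_left
      by (subst sum.swap) (simp add: frob_sum1 frob_fq1 mult_ac power_mult_distrib sum_distrib_left)
    ultimately show ?thesis by (simp add: rho_t_act_def sum.distrib distrib_left)
  qed
  then show ?case by (auto simp: Suc)
qed simp

text \<open>Both sides are polynomials in the same operator with coefficients fixed by
  Frobenius.\<close>

lemma rho_act_commute: "rho_act s u a (rho_act s u b x) p = rho_act s u b (rho_act s u a x) p"
proof -
  let ?A = "\<lambda>k. fq_embed \<iota> (coeff a k)" and ?B = "\<lambda>k. fq_embed \<iota> (coeff b k)"
  have expand: "rho_act s u a (rho_act s u b x) p = (\<Sum>j\<le>degree a. \<Sum>k\<le>degree b.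
      fq_embed \<iota> (coeff a j) * fq_embed \<iota> (coeff b k) * (rho_t_act s u ^^ (j + k)) x p)" for a b
    unfolding rho_act_def[abs_def] rho_t_act_power_linear
        by (simp add: sum_distrib_left mult.assoc funpow_add)
  show ?thesis
    unfolding expand by (subst sum.swap) (simp add: mult_ac add.commute)
qed

end

section \<open>Convergence and functional equation of the distinguished row\<close>

context t_module
begin

lemma y_sums:
  "l < r \<Longrightarrow> absv x < 1 \<Longrightarrow>
    (\<lambda>n. y n l * x ^ (CARD('f) ^ n)) sums lseries (blk_dim \<sigma>) ((!) \<omega>) l x"
  by (rule lseries_sums[of r _ "bd 0"]) (auto simp: dim_le \<omega>_le)

text \<open>Brackets are integral, so every entry of a block is dominated by its last one, for which
  the decay is known.\<close>

lemma row_coeff_tendsto_0: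
  assumes "p < d" "absv (z::'c) < 1"
  shows "(\<lambda>n. absv (row_coeff n p) * absv z ^ (CARD('f) ^ n)) \<longlonglongrightarrow> 0"
proof -
  obtain m j where m: "m < r" "j < bd m" and p: "p = start m + j"
    using block_position_exists[OF assms(1)] by blast
  have lim: "(\<lambda>n. absv (y n m) * absv z ^ (CARD('f) ^ n)) \<longlonglongrightarrow> 0"
    using lcoeff_tendsto_0[of r "blk_dim \<sigma>" "bd 0" "(!) \<omega>" m z] m assms(2) dim_le \<omega>_le by blast
  show ?thesis
  proof (rule tendsto_sandwich[OF _ _ tendsto_const lim])
    have "absv (row_coeff n p) \<le> absv (y n m)" for n
    proof -
      have "absv ((- bracket n) ^ (bd m - 1 - j)) \<le> 1"
        unfolding absv_power using absv_bracket_le[of n] by (intro power_le_one) auto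
      then show ?thesis
        unfolding p row_coeff_eq[OF m] absv_mult by (intro mult_right_le_one_le) auto
    qed
    then show "\<forall>\<^sub>F n in sequentially. absv (row_coeff n p) * absv z ^ (CARD('f) ^ n)
        \<le> absv (y n m) * absv z ^ (CARD('f) ^ n)"
      by (intro always_eventually allI mult_right_mono) auto
  qed auto
qed

definition log_row :: "(nat \<Rightarrow> 'c) \<Rightarrow> 'c" where
  "log_row x = (\<Sum>n. \<Sum>p<d. row_coeff n p * x p ^ (CARD('f) ^ n))"

lemma log_row_sums:
  assumes "\<And>p. p < d \<Longrightarrow> absv (x p) < 1"
  shows "(\<lambda>n. \<Sum>p<d. row_coeff n p * x p ^ (CARD('f) ^ n)) sums log_row x"
proof -
  have "summable (\<lambda>n. row_coeff n p * x p ^ (CARD('f) ^ n))" if "p < d" for p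
    by (rule summable_c)
      (use row_coeff_tendsto_0[OF that assms[OF that]] in \<open>simp add: absv_mult absv_power\<close>)
  then have "(\<lambda>n. \<Sum>p<d. row_coeff n p * x p ^ (CARD('f) ^ n))
      sums (\<Sum>p<d. \<Sum>n. row_coeff n p * x p ^ (CARD('f) ^ n))"
    by (intro sums_sum_c) (auto simp: summable_sums)
  then show ?thesis unfolding log_row_def by (simp add: sums_iff)
qed

lemma log_row_cong: "(\<And>p. p < d \<Longrightarrow> x p = x' p) \<Longrightarrow> log_row x = log_row x'"
  by (simp add: log_row_def)

lemma log_G_eq_log_row:
  assumes "x \<in> carrier_vec d"
  shows "log_G \<iota> \<sigma> \<omega> x $ (bd 0 - 1) = log_row (\<lambda>p. x $ p)"
  using row_less unfolding log_G_def tw_eval_def log_row_def row_coeff_def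
  by (simp add: mult_mat_vec_index_sum[OF log_coeffs_carrier assms] del: index_mult_mat_vec)

lemma absv_rho_t_0_le: "i < d \<Longrightarrow> j < d \<Longrightarrow> absv (rho_t \<iota> \<sigma> \<omega> 0 $$ (i, j)) \<le> 1"
  using absv_theta_le by (auto simp: rho_t_0_index N_mat_index)

lemma absv_E_le:
  assumes "i < d" "j < d"
  shows "absv (E_mat \<sigma> \<omega> $$ (i, j)) \<le> 1"
proof -
  obtain m k where m: "m < r" "k < bd m" and j: "j = start m + k"
    using block_position_exists[OF assms(2)] by blast
  show ?thesis
    unfolding j E_mat_index[OF assms(1) m]
    by (rule absv_sum_le) (use absv_E_coeff_le[of m "(!) \<omega>"] \<omega>_le m in auto)
qed

text \<open>The entries of \<theta> + N and E are integral, so the action keeps points inside the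
  domain of convergence.\<close>

lemma rho_t_act_max_ideal:
  assumes "\<And>p. p < d \<Longrightarrow> absv (x p) < 1" "p < d"
  shows "absv (rho_t_act \<sigma> \<omega> x p) < 1"
proof -
  have less: "absv (c * z) < 1" if "absv c \<le> 1" "absv z < 1" for c z :: 'c
    using mult_right_le_one_le[of "absv z" "absv c"] that by (simp add: absv_mult mult.commute)
  have "absv (\<Sum>k<d. rho_t \<iota> \<sigma> \<omega> 0 $$ (p, k) * x k) < 1"
    by (rule absv_sum_less) (use assms absv_rho_t_0_le less in auto)
  moreover have "absv (\<Sum>k<d. E_mat \<sigma> \<omega> $$ (p, k) * x k ^ CARD('f)) < 1"
  proof (rule absv_sum_less)
    fix k assume k: "k \<in> {..<d}"
    then have "absv (x k ^ CARD('f)) < 1"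
      using assms(1)[of k] unfolding absv_power by (intro power_less_one_iff[THEN iffD2]) auto
    then show "absv (E_mat \<sigma> \<omega> $$ (p, k) * x k ^ CARD('f)) < 1"
      using k assms(2) absv_E_le by (intro less) auto
  qed simp
  ultimately show ?thesis
    unfolding rho_t_act_def using absv_ultrametric[of "\<Sum>k<d. rho_t \<iota> \<sigma> \<omega> 0 $$ (p, k) * x k"]
        by (smt (verit))
qed

lemma rho_t_act_power_max_ideal:
  assumes "\<And>p. p < d \<Longrightarrow> absv (x p) < 1" "p < d"
  shows "absv ((rho_t_act \<sigma> \<omega> ^^ k) x p) < 1"
  using assms(2) by (induction k arbitrary: p) (auto simp: assms(1) intro: rho_t_act_max_ideal)

text \<open>The sums for \<open>log_row (rho_t_act x)\<close> and \<open>\<theta> log_row x\<close> telescope against each other.\<close>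

lemma log_row_rho_t_act:
  assumes x: "\<And>p. p < d \<Longrightarrow> absv (x p) < 1"
  shows "log_row (rho_t_act \<sigma> \<omega> x) = theta \<iota> * log_row x"
proof -
  let ?q = "CARD('f)"
  define A where "A n = (\<Sum>p<d. row_coeff n p * x p ^ (?q ^ n))" for n
  define B where "B n = (\<Sum>p<d. row_coeff n p * rho_t_act \<sigma> \<omega> x p ^ (?q ^ n))" for n
  \<comment> \<open>\<open>G n\<close> collects the E part of \<open>B n\<close> and
    \<open>H n\<close> the \<theta> + N part; the row recursion turns \<open>H (Suc n)\<close> into
    \<theta> \<open>A (Suc n)\<close> minus the preceding \<open>G n\<close>.\<close>
  define G where "G n = (\<Sum>k<d. (\<Sum>p<d. row_coeff n p * (E_mat \<sigma> \<omega> $$ (p, k)) ^ (?q ^ n))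
      * x k ^ (?q ^ Suc n))" for n
  define H where "H n = (\<Sum>k<d. (theta \<iota> ^ (?q ^ n) * row_coeff n k + (\<Sum>p<d. row_coeff n p
      * N_mat \<sigma> $$ (p, k))) * x k ^ (?q ^ n))" for n
  have B: "B n = H n + G n" for n
  proof -
    have "rho_t_act \<sigma> \<omega> x p ^ (?q ^ n)
        = (\<Sum>k<d. (rho_t \<iota> \<sigma> \<omega> 0 $$ (p, k)) ^ (?q ^ n) * x k ^ (?q ^ n))
       + (\<Sum>k<d. (E_mat \<sigma> \<omega> $$ (p, k)) ^ (?q ^ n) * x k ^ (?q ^ Suc n))" for p
      by (simp add: rho_t_act_def frob_add frob_sum power_mult_distrib flip: power_mult)
    then have "B n = (\<Sum>p<d. \<Sum>k<d. row_coeff n p * (rho_t \<iota> \<sigma> \<omega> 0 $$ (p, k)) ^ (?q ^ n)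
        * x k ^ (?q ^ n))
       + (\<Sum>p<d. \<Sum>k<d. row_coeff n p * (E_mat \<sigma> \<omega> $$ (p, k)) ^ (?q ^ n) * x k ^ (?q ^ Suc n))"
      by (simp add: B_def distrib_left sum.distrib sum_distrib_left mult.assoc)
    also have "(\<Sum>p<d. \<Sum>k<d. row_coeff n p * (E_mat \<sigma> \<omega> $$ (p, k)) ^ (?q ^ n) * x k ^ (?q ^ Suc n))
        = G n"
      unfolding G_def sum_distrib_right by (rule sum.swap)
    also have "(\<Sum>p<d. \<Sum>k<d. row_coeff n p * (rho_t \<iota> \<sigma> \<omega> 0 $$ (p, k)) ^ (?q ^ n) * x k ^ (?q ^ n))
       = (\<Sum>k<d. (\<Sum>p<d. row_coeff n p * (rho_t \<iota> \<sigma> \<omega> 0 $$ (p, k)) ^ (?q ^ n)) * x k ^ (?q ^ n))"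
      unfolding sum_distrib_right by (rule sum.swap)
    also have "\<dots> = H n" unfolding H_def by (simp add: sum_rho_t_0_right)
    finally show ?thesis .
  qed
  have H0: "H 0 = theta \<iota> * A 0"
  proof -
    have "(\<Sum>p<d. row_coeff 0 p * N_mat \<sigma> $$ (p, k)) = 0" if "k < d" for k
      by (rule sum.neutral) (use that N_row in \<open>auto simp: row_coeff_0\<close>)
    then show ?thesis by (simp add: H_def A_def sum_distrib_left mult.assoc)
  qed
  have H_Suc: "H (Suc n) = theta \<iota> * A (Suc n) - G n" for n
  proof -
    have "theta \<iota> ^ (?q ^ Suc n) * row_coeff (Suc n) k + (\<Sum>p<d. row_coeff (Suc n) p
        * N_mat \<sigma> $$ (p, k))
        = theta \<iota> * row_coeff (Suc n) k - (\<Sum>p<d. row_coeff n p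
            * (E_mat \<sigma> \<omega> $$ (p, k)) ^ (?q ^ n))" if "k < d" for k
      using row_coeff_rec[OF that, of n] by (simp add: bracket_def algebra_simps)
    then have "H (Suc n) = (\<Sum>k<d. (theta \<iota> * row_coeff (Suc n) k
        - (\<Sum>p<d. row_coeff n p * (E_mat \<sigma> \<omega> $$ (p, k)) ^ (?q ^ n))) * x k ^ (?q ^ Suc n))"
      unfolding H_def by (intro sum.cong) auto
    then show ?thesis
      by (simp add: A_def G_def left_diff_distrib sum_subtractf sum_distrib_left mult.assoc)
  qed
  \<comment> \<open>Only the boundary term \<open>G n\<close> survives the telescoping; it remains
    to show that it tends to 0.\<close>
  have partial: "(\<Sum>i<Suc n. B i) = theta \<iota> * (\<Sum>i<Suc n. A i) + G n" for n
    by (induction n) (simp_all add: B H0 H_Suc algebra_simps)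
  have "G \<longlonglongrightarrow> (\<Sum>k<d. \<Sum>p<d. 0)"
    unfolding G_def sum_distrib_right
  proof (intro tendsto_sum_c)
    fix k p assume "k \<in> {..<d}" "p \<in> {..<d}"
    then have k: "k < d" and p: "p < d" by auto
    show "(\<lambda>n. row_coeff n p * (E_mat \<sigma> \<omega> $$ (p, k)) ^ (?q ^ n) * x k ^ (?q ^ Suc n)) \<longlonglongrightarrow> 0"
      unfolding tendsto_iff_absv[where l = 0]
    proof (rule tendsto_sandwich[OF _ _ tendsto_const row_coeff_tendsto_0[OF p x[OF k]]])
      have "absv (row_coeff n p * (E_mat \<sigma> \<omega> $$ (p, k)) ^ (?q ^ n) * x k ^ (?q ^ Suc n))
          \<le> absv (row_coeff n p) * absv (x k) ^ (?q ^ n)" for n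
      proof -
        have "absv (x k) ^ (?q ^ Suc n) \<le> absv (x k) ^ (?q ^ n)"
          using x[OF k] card_field_ge_2[where 'f='f]
              by (intro power_decreasing power_increasing) auto
        moreover have "absv (row_coeff n p) * absv (E_mat \<sigma> \<omega> $$ (p, k)) ^ (?q ^ n)
            \<le> absv (row_coeff n p)"
          using absv_E_le[OF p k] by (intro mult_right_le_one_le power_le_one) auto
        ultimately show ?thesis
          unfolding absv_mult absv_power by (intro mult_mono) auto
      qed
      then show "\<forall>\<^sub>F n in sequentially. absv (row_coeff n p * (E_mat \<sigma> \<omega> $$ (p, k)) ^ (?q ^ n)
          * x k ^ (?q ^ Suc n) - 0)
          \<le> absv (row_coeff n p) * absv (x k) ^ (?q ^ n)" by simp
    qed auto
  qed
  then have G: "G \<longlonglongrightarrow> 0" by simp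
  have A: "A sums log_row x" unfolding A_def by (rule log_row_sums[OF x])
  have "(\<lambda>n. theta \<iota> * (\<Sum>i<Suc n. A i) + G n) \<longlonglongrightarrow> theta \<iota> * log_row x + 0"
    using A G unfolding sums_def by (intro tendsto_add_c tendsto_mult_left_c LIMSEQ_Suc)
  then have "(\<lambda>n. \<Sum>i<Suc n. B i) \<longlonglongrightarrow> theta \<iota> * log_row x" by (simp only: partial add_0_right)
  then have "B sums (theta \<iota> * log_row x)" unfolding sums_def by (rule LIMSEQ_imp_Suc)
  then show ?thesis unfolding log_row_def B_def by (rule sums_unique[symmetric])
qed

lemma log_row_rho_t_act_power:
  assumes "\<And>p. p < d \<Longrightarrow> absv (x p) < 1"
  shows "log_row ((rho_t_act \<sigma> \<omega> ^^ k) x) = theta \<iota> ^ k * log_row x"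
  by (induction k) (auto simp: log_row_rho_t_act rho_t_act_power_max_ideal assms mult.assoc)

lemma log_row_rho_act:
  assumes x: "\<And>p. p < d \<Longrightarrow> absv (x p) < 1"
  shows "log_row (rho_act \<sigma> \<omega> a x) = eval_theta \<iota> a * log_row x"
proof -
  let ?c = "\<lambda>k. fq_embed \<iota> (coeff a k)" and ?z = "\<lambda>k. (rho_t_act \<sigma> \<omega> ^^ k) x"
  have "(\<Sum>p<d. row_coeff n p * rho_act \<sigma> \<omega> a x p ^ (CARD('f) ^ n))
      = (\<Sum>k\<le>degree a. ?c k * (\<Sum>p<d. row_coeff n p * ?z k p ^ (CARD('f) ^ n)))" for n
    unfolding rho_act_def sum_distrib_left
    by (subst sum.swap) (simp add: frob_sum frob_fq power_mult_distrib sum_distrib_left mult_ac)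
  moreover have "(\<lambda>n. \<Sum>k\<le>degree a. ?c k * (\<Sum>p<d. row_coeff n p * ?z k p ^ (CARD('f) ^ n)))
      sums (\<Sum>k\<le>degree a. ?c k * log_row (?z k))"
    by (intro sums_sum_c sums_mult_c log_row_sums rho_t_act_power_max_ideal x)
  ultimately have "log_row (rho_act \<sigma> \<omega> a x) = (\<Sum>k\<le>degree a. ?c k * log_row (?z k))"
    unfolding log_row_def[of "rho_act \<sigma> \<omega> a x"] by (simp add: sums_iff)
  then show ?thesis by (simp add: log_row_rho_t_act_power x eval_theta_sum sum_distrib_right
      mult.assoc)
qed

lemma rho_act_cong: "(\<And>k. k < d \<Longrightarrow> x k = x' k) \<Longrightarrow> p < d \<Longrightarrow> rho_act \<sigma> \<omega> a x p = rho_act \<sigma> \<omega> a x' p"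
proof -
  assume *: "\<And>k. k < d \<Longrightarrow> x k = x' k" "p < d"
  have "(rho_t_act \<sigma> \<omega> ^^ k) x p = (rho_t_act \<sigma> \<omega> ^^ k) x' p" for k
    using * rho_t_act_cong[of \<sigma> x x' \<omega>]
        by (cases k) (simp_all add: funpow_Suc_right del: funpow.simps)
  then show ?thesis by (simp add: rho_act_def)
qed

text \<open>Applying \<rho>\<open>\<^sub>b\<close> to \<rho>\<open>\<^sub>a\<close>(v) and
  \<rho>\<open>\<^sub>a\<close> to \<rho>\<open>\<^sub>b\<close>(v) gives the same point. The
  functional equation is used only at \<rho>\<open>\<^sub>a\<close>(v) and
  \<rho>\<open>\<^sub>b\<close>(v), as the special point v may lie outside the domain of
  convergence.\<close>

lemma log_row_rho_point_ratio:
  assumes a: "a \<noteq> 0" "rho_point \<iota> \<sigma> \<omega> a \<in> G_max_ideal \<sigma>"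
    and b: "b \<noteq> 0" "rho_point \<iota> \<sigma> \<omega> b \<in> G_max_ideal \<sigma>"
  shows "log_row (\<lambda>p. rho_point \<iota> \<sigma> \<omega> a $ p) / eval_theta \<iota> a
    = log_row (\<lambda>p. rho_point \<iota> \<sigma> \<omega> b $ p) / eval_theta \<iota> b"
proof -
  let ?x = "\<lambda>p. special_point \<sigma> \<omega> $ p"
  have *: "eval_theta \<iota> b * log_row (\<lambda>p. rho_point \<iota> \<sigma> \<omega> a $ p)
      = log_row (rho_act \<sigma> \<omega> b (rho_act \<sigma> \<omega> a ?x))"
    if "rho_point \<iota> \<sigma> \<omega> a \<in> G_max_ideal \<sigma>" for a b :: "'f poly"
  proof -
    have "absv (rho_point \<iota> \<sigma> \<omega> a $ p) < 1" if "p < d" for p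
      using that \<open>rho_point \<iota> \<sigma> \<omega> a \<in> G_max_ideal \<sigma>\<close> by (auto simp: G_max_ideal_def max_ideal_def)
    then have "eval_theta \<iota> b * log_row (\<lambda>p. rho_point \<iota> \<sigma> \<omega> a $ p)
        = log_row (rho_act \<sigma> \<omega> b (\<lambda>p. rho_point \<iota> \<sigma> \<omega> a $ p))"
      by (simp add: log_row_rho_act)
    also have "\<dots> = log_row (rho_act \<sigma> \<omega> b (rho_act \<sigma> \<omega> a ?x))"
      by (intro log_row_cong rho_act_cong) (simp_all add: rho_point_index)
    finally show ?thesis .
  qed
  have "log_row (rho_act \<sigma> \<omega> b (rho_act \<sigma> \<omega> a ?x)) = log_row (rho_act \<sigma> \<omega> a (rho_act \<sigma> \<omega> b ?x))"
    by (intro log_row_cong rho_act_commute)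
  then have "eval_theta \<iota> b * log_row (\<lambda>p. rho_point \<iota> \<sigma> \<omega> a $ p)
      = eval_theta \<iota> a * log_row (\<lambda>p. rho_point \<iota> \<sigma> \<omega> b $ p)"
    using *[OF a(2)] *[OF b(2)] by metis
  then show ?thesis using eval_theta_nonzero[OF a(1)] eval_theta_nonzero[OF b(1)]
    by (simp add: field_simps)
qed

text \<open>The given a proves that the \<open>SOME\<close> in \<open>Li_star\<close> has a witness,
  and independence of the choice moves the value to a itself.\<close>

lemma Li_star_eq_log_row:
  assumes "a \<noteq> 0" "rho_point \<iota> \<sigma> \<omega> a \<in> G_max_ideal \<sigma>"
  shows "Li_star \<iota> (rev \<sigma>) (rev \<omega>)
    = (- 1) ^ (r - 1) / eval_theta \<iota> a * log_row (\<lambda>p. rho_point \<iota> \<sigma> \<omega> a $ p)"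
proof -
  define b where "b = (SOME b. b \<noteq> 0 \<and> rho_point \<iota> \<sigma> \<omega> b \<in> G_max_ideal \<sigma>)"
  have b: "b \<noteq> 0 \<and> rho_point \<iota> \<sigma> \<omega> b \<in> G_max_ideal \<sigma>"
    unfolding b_def by (rule someI[where x = a]) (use assms in auto)
  have "Li_star \<iota> (rev \<sigma>) (rev \<omega>) = (- 1) ^ (r - 1) / eval_theta \<iota> b
      * log_G \<iota> \<sigma> \<omega> (rho_point \<iota> \<sigma> \<omega> b) $ (bd 0 - 1)"
    using \<sigma>_nonempty by (simp add: Li_star_def b_def Let_def)
  also have "\<dots> = (- 1) ^ (r - 1) * (log_row (\<lambda>p. rho_point \<iota> \<sigma> \<omega> b $ p) / eval_theta \<iota> b)"
    using b log_G_eq_log_row[of "rho_point \<iota> \<sigma> \<omega> b"] by (simp add: G_max_ideal_def)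
  also have "\<dots> = (- 1) ^ (r - 1) * (log_row (\<lambda>p. rho_point \<iota> \<sigma> \<omega> a $ p) / eval_theta \<iota> a)"
    using log_row_rho_point_ratio[of a b] assms b by simp
  finally show ?thesis by simp
qed

section \<open>Binomial expansion of the logarithm coordinate\<close>

lemma minus_bracket_power:
  "(- bracket n) ^ j = (\<Sum>l\<le>j. (- 1) ^ (j + l) * of_nat (j choose l) * theta \<iota> ^ l * (theta \<iota> ^ (j
      - l)) ^ (CARD('f) ^ n))"
proof -
  \<comment> \<open>Expanding \<theta> - \<theta>^(q^n) leaves \<theta>^(j-l) under a q^n-th power,
    ready to be absorbed into the argument of a series.\<close>
  have "(- bracket n) ^ j = (theta \<iota> + (- 1) * theta \<iota> ^ (CARD('f) ^ n)) ^ j"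
    by (simp add: bracket_def)
  also have "\<dots> = (\<Sum>l\<le>j. of_nat (j choose l) * theta \<iota> ^ l * ((- 1)
      * theta \<iota> ^ (CARD('f) ^ n)) ^ (j - l))"
    by (rule binomial_ring)
  also have "\<dots> = (\<Sum>l\<le>j. (- 1) ^ (j + l) * of_nat (j choose l) * theta \<iota> ^ l * (theta \<iota> ^ (j
      - l)) ^ (CARD('f) ^ n))"
  proof (rule sum.cong[OF refl])
    fix l assume "l \<in> {..j}"
    then have "j + l = j - l + 2 * l" by auto
    then have "(- 1 :: 'c) ^ (j + l) = (- 1) ^ (j - l)"
        by (metis power_add power_minus1_even mult.right_neutral)
    moreover have "(theta \<iota> ^ (CARD('f) ^ n)) ^ (j - l) = (theta \<iota> ^ (j - l)) ^ (CARD('f) ^ n)"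
      by (simp only: power_mult[symmetric] mult.commute)
    ultimately show "of_nat (j choose l) * theta \<iota> ^ l * ((- 1) * theta \<iota> ^ (CARD('f) ^ n)) ^ (j
        - l)
      = (- 1) ^ (j + l) * of_nat (j choose l) * theta \<iota> ^ l * (theta \<iota> ^ (j - l)) ^ (CARD('f) ^ n)"
      by (simp only: power_mult_distrib mult_ac)
  qed
  finally show ?thesis .
qed

text \<open>Offsets are counted from the end of each block, so that j is the exponent of -[n]; hence
  the coordinate at \<open>bd m - Suc j\<close>.\<close>

lemma log_row_expansion:
  assumes x: "\<And>p. p < d \<Longrightarrow> absv (x p) < 1"
  shows "log_row x = (\<Sum>m<r. \<Sum>j<bd m. \<Sum>l\<le>j. (- 1) ^ (j + l) * of_nat (j choose l) * theta \<iota> ^ l *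
    lseries (blk_dim \<sigma>) ((!) \<omega>) m (theta \<iota> ^ (j - l) * x (start m + (bd m - Suc j))))"
proof -
  let ?c = "\<lambda>j l. (- 1) ^ (j + l) * of_nat (j choose l) * theta \<iota> ^ l"
    and ?z = "\<lambda>m j l. theta \<iota> ^ (j - l) * x (start m + (bd m - Suc j))"
  have "(\<Sum>p<d. row_coeff n p * x p ^ (CARD('f) ^ n))
      = (\<Sum>m<r. \<Sum>j<bd m. \<Sum>l\<le>j. ?c j l * (y n m * ?z m j l ^ (CARD('f) ^ n)))" for n
  proof -
    have "(\<Sum>p<d. row_coeff n p * x p ^ (CARD('f) ^ n))
        = (\<Sum>m<r. \<Sum>j<bd m. row_coeff n (start m + j) * x (start m + j) ^ (CARD('f) ^ n))"
      by (rule sum_tot_dim)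
    also have "\<dots> = (\<Sum>m<r. \<Sum>j<bd m. row_coeff n (start m + (bd m - Suc j)) * x (start m + (bd m
        - Suc j)) ^ (CARD('f) ^ n))"
      by (intro sum.cong refl sum.nat_diff_reindex[symmetric])
    also have "\<dots> = (\<Sum>m<r. \<Sum>j<bd m. \<Sum>l\<le>j. ?c j l * (y n m * ?z m j l ^ (CARD('f) ^ n)))"
    proof (intro sum.cong refl)
      fix m j assume "m \<in> {..<r}" "j \<in> {..<bd m}"
      then have m: "m < r" "bd m - Suc j < bd m" and exp: "bd m - 1 - (bd m - Suc j) = j" by auto
      have "row_coeff n (start m + (bd m - Suc j)) = y n m * (- bracket n) ^ j"
        using row_coeff_eq[OF m, of n] unfolding exp .
      then show "row_coeff n (start m + (bd m - Suc j)) * x (start m + (bd m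
          - Suc j)) ^ (CARD('f) ^ n)
        = (\<Sum>l\<le>j. ?c j l * (y n m * ?z m j l ^ (CARD('f) ^ n)))"
        unfolding minus_bracket_power
        by (simp add: sum_distrib_left sum_distrib_right power_mult_distrib mult_ac)
    qed
    finally show ?thesis .
  qed
  moreover have "(\<lambda>n. \<Sum>m<r. \<Sum>j<bd m. \<Sum>l\<le>j. ?c j l * (y n m * ?z m j l ^ (CARD('f) ^ n)))
     sums (\<Sum>m<r. \<Sum>j<bd m. \<Sum>l\<le>j. ?c j l * lseries (blk_dim \<sigma>) ((!) \<omega>) m (?z m j l))"
  proof (intro sums_sum_c sums_mult_c y_sums)
    fix m j l assume "m \<in> {..<r}" "j \<in> {..<bd m}"
    then have "absv (x (start m + (bd m - Suc j))) < 1"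
      by (intro x blk_start_add_less_tot) auto
    moreover have "absv (theta \<iota>) ^ (j - l) \<le> 1" using absv_theta_le by (intro power_le_one) auto
    ultimately show "absv (?z m j l) < 1"
      unfolding absv_mult absv_power
      by (meson absv_nonneg le_less_trans mult_left_le_one_le zero_le_power)
  qed auto
  ultimately show ?thesis unfolding log_row_def by (simp add: sums_iff)
qed

end

section \<open>Star polylogarithms with small first argument\<close>

context v_adic_complex_field
begin

lemma lseries_0 [simp]: "lseries D w l 0 = 0"
  by (simp add: lseries_def power_0_left)

lemma lseries_cong:
  assumes "\<And>k. k \<le> l \<Longrightarrow> D k = D' k" "\<And>k. k < l \<Longrightarrow> w k = w' k"
  shows "lseries D w l = lseries D' w' l"
  using lcoeff_cong[OF assms] by (simp add: lseries_def fun_eq_iff)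

end

context t_module
begin

lemma lseries_minus:
  assumes "l < r" "absv x < 1"
  shows "lseries (blk_dim \<sigma>) ((!) \<omega>) l (- x) = - lseries (blk_dim \<sigma>) ((!) \<omega>) l x"
proof -
  have "(\<lambda>n. (- 1) * (y n l * x ^ (CARD('f) ^ n))) sums ((- 1) * lseries (blk_dim \<sigma>) ((!) \<omega>) l x)"
    by (rule sums_mult_c[OF y_sums[OF assms]])
  then show ?thesis
    by (simp add: lseries_def[of _ _ _ "- x"] frob_minus sums_iff)
qed

text \<open>The last argument is split off, which leaves a corner entry of E with the same sign
  exponent. This factor becomes the variable of the polylogarithm.\<close>

lemma special_point_index:
  assumes "m < r" "j < bd m"
  shows "special_point \<sigma> \<omega> $ (start m + j)
    = (if j = bd m - 1 then e m (r - 1) * \<omega> ! (r - 1) else 0)"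
proof -
  have eq: "start m + j = blk_last \<sigma> l \<longleftrightarrow> l = m \<and> j = bd m - 1" if "l < r" for l
    using block_position_unique[of j \<sigma> m "bd l - 1" l] assms dim_pos[OF that] that
    by (auto simp: blk_last_eq)
  have "special_point \<sigma> \<omega> $ (start m + j) = (\<Sum>l<r. if start m + j = blk_last \<sigma> l
      then (- 1) ^ (r - 1 - l) * (\<Prod>e\<in>{l..<r}. \<omega> ! e) else 0)"
    using blk_start_add_less_tot[OF assms] by (simp add: special_point_def)
  also have "\<dots> = (\<Sum>l<r. if l = m then (if j = bd m - 1
      then (- 1) ^ (r - 1 - l) * (\<Prod>e\<in>{l..<r}. \<omega> ! e) else 0) else 0)"
    by (intro sum.cong refl) (auto simp: eq)
  also have "\<dots> = (if j = bd m - 1 then (- 1) ^ (r - 1 - m) * (\<Prod>e\<in>{m..<r}. \<omega> ! e) else 0)"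
    using assms by simp
  also have "{m..<r} = insert (r - 1) {m..<r - 1}" using assms by auto
  also have "(\<Prod>e\<in>\<dots>. \<omega> ! e) = (\<Prod>e\<in>{m..<r - 1}. \<omega> ! e) * \<omega> ! (r - 1)"
    by (simp add: mult.commute)
  finally show ?thesis by (simp add: E_coeff_def)
qed

text \<open>A small last argument puts the special point itself into the maximal ideal, so a = 1 is
  admissible. Its only nonzero coordinates end the blocks, which leaves j = 0 in the
  expansion.\<close>

lemma Li_star_small:
  assumes "absv (\<omega> ! (r - 1)) < 1"
  shows "Li_star \<iota> (rev \<sigma>) (rev \<omega>) = (- 1) ^ (r - 1) *
    (\<Sum>m<r. lseries (blk_dim \<sigma>) ((!) \<omega>) m (e m (r - 1) * \<omega> ! (r - 1)))"
proof -
  let ?x = "\<lambda>p. special_point \<sigma> \<omega> $ p"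
  have small: "absv (?x p) < 1" if "p < d" for p
  proof -
    obtain m j where m: "m < r" "j < bd m" and p: "p = start m + j"
      using block_position_exists[OF \<open>p < d\<close>] by blast
    have "absv (e m (r - 1)) \<le> 1" by (rule absv_E_coeff_le) (use \<omega>_le in auto)
    then have "absv (e m (r - 1) * \<omega> ! (r - 1)) < 1"
      unfolding absv_mult using assms by (meson absv_nonneg le_less_trans mult_left_le_one_le)
    then show ?thesis unfolding p special_point_index[OF m] by simp
  qed
  have rho1: "rho_point \<iota> \<sigma> \<omega> 1 $ p = ?x p" if "p < d" for p
    using that by (simp add: rho_point_index rho_act_def fq_embed_1)
  have "rho_point \<iota> \<sigma> \<omega> 1 \<in> G_max_ideal \<sigma>"
    using rho1 small by (simp add: G_max_ideal_def max_ideal_def)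
      (simp add: rho_point_def tw_eval_def)
  then have "Li_star \<iota> (rev \<sigma>) (rev \<omega>) = (- 1) ^ (r - 1) * log_row (\<lambda>p. rho_point \<iota> \<sigma> \<omega> 1 $ p)"
    using Li_star_eq_log_row[of 1] by (simp add: eval_theta_1)
  also have "log_row (\<lambda>p. rho_point \<iota> \<sigma> \<omega> 1 $ p) = log_row ?x"
    by (rule log_row_cong) (rule rho1)
  also have "\<dots> = (\<Sum>m<r. \<Sum>j<bd m. \<Sum>l\<le>j. (- 1) ^ (j + l) * of_nat (j choose l) * theta \<iota> ^ l *
    lseries (blk_dim \<sigma>) ((!) \<omega>) m (theta \<iota> ^ (j - l) * ?x (start m + (bd m - Suc j))))"
    by (rule log_row_expansion[OF small])
  also have "\<dots> = (\<Sum>m<r. \<Sum>j\<in>{0}. \<Sum>l\<le>j. (- 1) ^ (j + l) * of_nat (j choose l) * theta \<iota> ^ l *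
    lseries (blk_dim \<sigma>) ((!) \<omega>) m (theta \<iota> ^ (j - l) * ?x (start m + (bd m - Suc j))))"
  proof (intro sum.cong[OF refl] sum.mono_neutral_right ballI)
    fix m j assume "m \<in> {..<r}" "j \<in> {..<bd m} - {0}"
    then have "?x (start m + (bd m - Suc j)) = 0"
      by (subst special_point_index) auto
    then show "(\<Sum>l\<le>j. (- 1) ^ (j + l) * of_nat (j choose l) * theta \<iota> ^ l *
        lseries (blk_dim \<sigma>) ((!) \<omega>) m (theta \<iota> ^ (j - l) * ?x (start m + (bd m - Suc j)))) = 0"
      by (simp only: mult_zero_right lseries_0 sum.neutral_const)
  qed (use dim_pos in auto)
  also have "\<dots> = (\<Sum>m<r. lseries (blk_dim \<sigma>) ((!) \<omega>) m (e m (r - 1) * \<omega> ! (r - 1)))"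
    using dim_pos special_point_index[of _ "bd _ - 1"] by (intro sum.cong refl) simp
  finally show ?thesis .
qed

text \<open>Replacing the tail from n on by its sum keeps the block lengths up to n, and the
  arguments before n stay the same. By locality the series are those of the original module.\<close>

lemma Li_star_merged:
  assumes "n < r" "absv x < 1"
  shows "Li_star \<iota> (rev (take n \<sigma> @ [sum_list (drop n \<sigma>)])) (rev (take n \<omega> @ [x]))
    = (- 1) ^ n * (\<Sum>l\<le>n. lseries (blk_dim \<sigma>) ((!) \<omega>) l (e l n * x))"
proof -
  let ?s = "take n \<sigma> @ [sum_list (drop n \<sigma>)]" and ?w = "take n \<omega> @ [x]"
  have len: "length ?s = Suc n" "length ?w = Suc n" using assms length_\<omega> by auto
  interpret M: t_module v \<iota> ?s ?w
  proof
    show "?s ! i \<ge> 1" if "i < length ?s" for i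
      using that dim_pos[OF assms(1)] \<sigma>_pos[of i] assms(1)
      by (cases "i < n") (auto simp: nth_append blk_dim_def not_less less_Suc_eq Suc_le_eq)
    show "absv (?w ! i) \<le> 1" if "i < length ?s" for i
      using that \<omega>_le[of i] assms length_\<omega>
          by (cases "i < n") (auto simp: nth_append not_less less_Suc_eq)
  qed (use assms length_\<omega> in auto)
  have dims: "blk_dim ?s l = bd l" if "l \<le> n" for l
  proof -
    have "drop l ?s = drop l (take n \<sigma>) @ [sum_list (drop n \<sigma>)]" using that assms(1) by simp
    moreover have "drop l \<sigma> = drop l (take n \<sigma>) @ drop n \<sigma>"
      using that assms(1) by (metis append_take_drop_id drop_append diff_is_0_eq drop0 length_take
          min.absorb2 less_imp_le)
    ultimately show ?thesis by (simp add: blk_dim_def)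
  qed
  have w: "?w ! l = \<omega> ! l" if "l < n" for l
    using that assms length_\<omega> by (simp add: nth_append)
  have wn: "?w ! n = x" using assms length_\<omega> by (simp add: nth_append)
  have ec: "E_coeff ((!) ?w) l n = e l n" for l
    unfolding E_coeff_def by (intro arg_cong2[where f="(*)"] refl prod.cong) (auto simp: w)
  have ls: "lseries (blk_dim ?s) ((!) ?w) l = lseries (blk_dim \<sigma>) ((!) \<omega>) l" if "l \<le> n" for l
    by (rule lseries_cong) (use that dims w in auto)
  have "Li_star \<iota> (rev ?s) (rev ?w) = (- 1) ^ n * (\<Sum>l<Suc n. lseries (blk_dim ?s) ((!) ?w) l
      (E_coeff ((!) ?w) l n * ?w ! n))"
    using M.Li_star_small unfolding len by (simp only: diff_Suc_1 wn assms(2) simp_thms)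
  also have "\<dots> = (- 1) ^ n * (\<Sum>l\<le>n. lseries (blk_dim \<sigma>) ((!) \<omega>) l (e l n * x))"
    unfolding lessThan_Suc_atMost ec wn
        by (intro arg_cong2[where f="(*)"] refl sum.cong) (auto simp: ls)
  finally show ?thesis .
qed

text \<open>Passing from n to n+1 in the corner entry multiplies by
  -\<omega>\<open>\<^sub>n\<close>, so the series with l \<le> n are opposite in the two sums. The
  prefactors are opposite as well, so these terms cancel and only l = n+1, with corner entry 1,
  remains.\<close>

lemma Li_star_merged_diff:
  assumes "Suc n < r" "absv x < 1"
  shows "Li_star \<iota> (rev (take (Suc n) \<sigma> @ [sum_list (drop (Suc n) \<sigma>)])) (rev (take (Suc n) \<omega> @ [x]))
    - Li_star \<iota> (rev (take n \<sigma> @ [sum_list (drop n \<sigma>)])) (rev (take n \<omega> @ [x * \<omega> ! n]))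
    = (- 1) ^ Suc n * lseries (blk_dim \<sigma>) ((!) \<omega>) (Suc n) x"
proof -
  let ?F = "lseries (blk_dim \<sigma>) ((!) \<omega>)"
  have x: "absv (x * \<omega> ! n) < 1"
    unfolding absv_mult using assms \<omega>_le[of n]
    by (meson Suc_lessD absv_nonneg le_less_trans mult_right_le_one_le)
  have "?F l (e l (Suc n) * x) = - ?F l (e l n * (x * \<omega> ! n))" if "l \<le> n" for l
  proof -
    have "{l..<Suc n} = insert n {l..<n}" using that by auto
    then have "e l (Suc n) * x = - (e l n * (x * \<omega> ! n))"
      using that by (simp add: E_coeff_def Suc_diff_le mult_ac)
    moreover have "absv (e l n) \<le> 1" by (rule absv_E_coeff_le) (use \<omega>_le assms in auto)
    then have "absv (e l n * (x * \<omega> ! n)) < 1"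
      unfolding absv_mult[of "e l n"] using x
          by (meson absv_nonneg le_less_trans mult_left_le_one_le)
    ultimately show ?thesis using that assms by (simp only:) (rule lseries_minus, auto)
  qed
  then have "(\<Sum>l\<le>n. ?F l (e l (Suc n) * x)) = - (\<Sum>l\<le>n. ?F l (e l n * (x * \<omega> ! n)))"
    unfolding sum_negf[symmetric] by (intro sum.cong) auto
  moreover have "e (Suc n) (Suc n) = 1" by (simp add: E_coeff_def)
  ultimately show ?thesis
    using Li_star_merged[OF assms] Li_star_merged[OF _ x] assms by (simp add: algebra_simps)
qed

end

section \<open>Translation back to the unreversed index\<close>

theorem theorem3p11:
  fixes v :: "'f::{field,finite} poly"
    and \<iota> :: "'f poly fract \<Rightarrow> 'c::{field,complete_space}"
    and r :: nat
    and s :: "nat list"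
    and u :: "'c list"
    and a :: "'f poly"
    and dt :: "nat \<Rightarrow> nat"
    and V :: "nat \<Rightarrow> nat \<Rightarrow> 'c"
  assumes "v_adic_complex_field v \<iota>"
    and "r \<ge> 1" and "length s = r" and "length u = r"
    and "\<forall>i<r. s ! i \<ge> 1"
    and "\<forall>i<r. u ! i \<in> k_bar \<iota> - {0} \<and> absv (u ! i) \<le> 1"
    and "a \<noteq> 0"
    and "rho_point \<iota> (rev s) (rev u) a \<in> G_max_ideal (rev s)"
    and "dt = (\<lambda>m. sum_list (take (r + 1 - m) s))"
    and "V = (\<lambda>m j. rho_point \<iota> (rev s) (rev u) a $ (blk_start (rev s) (m - 1) + (j - 1)))"
  shows "Li_star \<iota> s u =
    (- 1) ^ (r - 1) / eval_theta \<iota> a *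
    (\<Sum>m = 1..r. \<Sum>j = 0..dt m - 1. \<Sum>l = 0..j.
       (- 1) ^ (j + l + m - 1) * of_nat (j choose l) * theta \<iota> ^ l *
       (Li_star \<iota> (merge_index (r + 1 - m) s)
          (theta \<iota> ^ (j - l) * V m (dt m - j) # drop (r + 1 - m) u)
        - Li_star \<iota> (merge_index (r + 2 - m) s)
          (theta \<iota> ^ (j - l) * V m (dt m - j) * u ! (r + 1 - m) # drop (r + 2 - m) u)))"
proof -
  interpret v_adic_complex_field v \<iota> by (rule assms(1))
  interpret t: t_module v \<iota> "rev s" "rev u"
    by unfold_locales (use assms in \<open>auto simp: rev_nth\<close>)
  let ?P = "rho_point \<iota> (rev s) (rev u) a" and ?F = "lseries (blk_dim (rev s)) ((!) (rev u))"
  have P_small: "absv (?P $ p) < 1" if "p < tot_dim (rev s)" for p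
    using assms(8) that by (auto simp: G_max_ideal_def max_ideal_def)
  have bd: "blk_dim (rev s) n = sum_list (take (r - n) s)" for n
  proof -
    have "drop n (rev s) = rev (take (r - n) s)" using assms(3) by (simp add: drop_rev)
    then show ?thesis by (simp add: blk_dim_def)
  qed
  \<comment> \<open>Merging the first r - n entries of s is merging the tail from n on in the
    reversed list.\<close>
  have merged: "merge_index (r - n) s = rev (take n (rev s) @ [sum_list (drop n (rev s))])"
    "x # drop (r - n) u = rev (take n (rev u) @ [x])" if "n < r" for n and x :: 'c
    using that assms(3,4) bd[of n] by (auto simp: merge_index_def take_rev blk_dim_def)
  have diff: "Li_star \<iota> (merge_index (r + 1 - Suc n) s) (x # drop (r + 1 - Suc n) u)
      - Li_star \<iota> (merge_index (r + 2 - Suc n) s) (x * u ! (r + 1 - Suc n) # drop (r + 2 - Suc n) u)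
      = (- 1) ^ n * ?F n x" if "n < r" "absv x < 1" for n x
  proof (cases n)
    case 0
    \<comment> \<open>The index r + 1 exceeds the length, so \<open>merge_index\<close> is empty and
      the term is 0, whatever the out-of-range \<open>u ! r\<close> denotes.\<close>
    have "Li_star \<iota> (merge_index (r + 2 - Suc n) s) w = 0" for w
      using 0 assms(3) by (simp add: merge_index_def Li_star_def)
    moreover have "Li_star \<iota> (merge_index (r - 0) s) (x # drop (r - 0) u) = ?F 0 x"
      unfolding merged[of 0, OF that(1)[unfolded 0]]
      using t.Li_star_merged[of 0 x] that 0 assms(3) by (simp add: E_coeff_def)
    ultimately show ?thesis using 0 by simp
  next
    case (Suc k)
    have idx: "r + 1 - Suc n = r - Suc k" "r + 2 - Suc n = r - k" using Suc by auto
    have "u ! (r - Suc k) = rev u ! k" using that Suc assms(4) by (simp add: rev_nth)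
    then show ?thesis
      unfolding idx using merged[of "Suc k"] merged[of k] t.Li_star_merged_diff[of k x] that
          assms(3)
      by (simp only: Suc length_rev Suc_lessD)
  qed
  have "Li_star \<iota> s u = (- 1) ^ (r - 1) / eval_theta \<iota> a * t.log_row (\<lambda>p. ?P $ p)"
    using t.Li_star_eq_log_row[OF assms(7,8)] assms(3) by simp
  also have "t.log_row (\<lambda>p. ?P $ p) = (\<Sum>n<r. \<Sum>j<blk_dim (rev s) n. \<Sum>l\<le>j.
      (- 1) ^ (j + l) * of_nat (j choose l) * theta \<iota> ^ l *
      ?F n (theta \<iota> ^ (j - l) * ?P $ (blk_start (rev s) n + (blk_dim (rev s) n - Suc j))))"
    using t.log_row_expansion[of "\<lambda>p. ?P $ p"] P_small assms(3) by simp
  \<comment> \<open>Termwise comparison with n = m - 1, since blocks are numbered from 0 in the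
    module and from 1 in the claim.\<close>
  also have "\<dots> = (\<Sum>n<r. \<Sum>j = 0..dt (Suc n) - 1. \<Sum>l = 0..j.
       (- 1) ^ (j + l + Suc n - 1) * of_nat (j choose l) * theta \<iota> ^ l *
       (Li_star \<iota> (merge_index (r + 1 - Suc n) s)
          (theta \<iota> ^ (j - l) * V (Suc n) (dt (Suc n) - j) # drop (r + 1 - Suc n) u)
        - Li_star \<iota> (merge_index (r + 2 - Suc n) s)
          (theta \<iota> ^ (j - l) * V (Suc n) (dt (Suc n) - j) * u ! (r + 1 - Suc n) # drop (r + 2
              - Suc n) u)))"
  proof (intro sum.cong)
    fix n assume "n \<in> {..<r}"
    then have n: "n < r" by simp
    have dt: "dt (Suc n) = blk_dim (rev s) n" by (simp add: assms(9) bd)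
    have pos: "blk_dim (rev s) n > 0" using t.dim_pos[of n] n assms(3) by simp
    show "{..<blk_dim (rev s) n} = {0..dt (Suc n) - 1}" using pos unfolding dt by auto
    fix j assume "j \<in> {0..dt (Suc n) - 1}"
    then have j: "j < blk_dim (rev s) n" using pos unfolding dt by auto
    show "{..j} = {0..j}" by auto
    fix l
    let ?z = "theta \<iota> ^ (j - l) * ?P $ (blk_start (rev s) n + (blk_dim (rev s) n - Suc j))"
    \<comment> \<open>V counts coordinates from 1, which accounts for \<open>Suc j\<close> in the
      position.\<close>
    have V: "V (Suc n) (dt (Suc n) - j) = ?P $ (blk_start (rev s) n + (blk_dim (rev s) n - Suc j))"
      unfolding assms(10) dt by simp
    have "absv (?P $ (blk_start (rev s) n + (blk_dim (rev s) n - Suc j))) < 1"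
      using n pos assms(3) by (intro P_small blk_start_add_less_tot) auto
    moreover have "absv (theta \<iota>) ^ (j - l) \<le> 1" using absv_theta_le by (intro power_le_one) auto
    ultimately have z: "absv ?z < 1"
      unfolding absv_mult absv_power
      by (meson absv_nonneg le_less_trans mult_left_le_one_le zero_le_power)
    \<comment> \<open>The sign (-1)^(m-1) of the claim cancels the sign (-1)^n with which the
      difference of polylogarithms produces its series.\<close>
    have sgn: "(- 1 :: 'c) ^ (j + l + Suc n - 1) * (- 1) ^ n = (- 1) ^ (j + l)"
      by (simp add: power_add flip: power_mult_distrib)
    show "(- 1) ^ (j + l) * of_nat (j choose l) * theta \<iota> ^ l * ?F n ?z
      = (- 1) ^ (j + l + Suc n - 1) * of_nat (j choose l) * theta \<iota> ^ l *
       (Li_star \<iota> (merge_index (r + 1 - Suc n) s)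
          (theta \<iota> ^ (j - l) * V (Suc n) (dt (Suc n) - j) # drop (r + 1 - Suc n) u)
        - Li_star \<iota> (merge_index (r + 2 - Suc n) s)
          (theta \<iota> ^ (j - l) * V (Suc n) (dt (Suc n) - j) * u ! (r + 1 - Suc n) # drop (r + 2
              - Suc n) u))"
      unfolding V diff[OF n z] sgn[symmetric] by (simp only: mult_ac)
  qed simp
  finally show ?thesis
    unfolding One_nat_def sum.atLeast1_atMost_eq by (simp only: One_nat_def)
qed

end
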